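(* Let $\Delta$ be an irreducible reduced root system not of type $A_n$, let $S\subset\Pi_l$, and let $\gamma$ be a maximal element (with respect to $\preccurlyeq$) of $\Delta^+\setminus\bigcup_{\alpha\in S}I(\alpha)_{\sf max}$. Then $\gamma\in\mathcal H$.
   Context: $\Delta^+$, $\Pi$, $\theta$: positive roots, simple roots, highest root; $W$ the Weyl group, $(\ ,\ )$ a $W$-invariant inner product; $\mu\preccurlyeq\nu$ iff $\nu-\mu$ is a non-negative integral combination of simple roots. $\Delta^+_l$ is the set of long positive roots and $\Pi_l=\Pi\cap\Delta^+_l$ (all roots are long in the simply-laced case). $\mathcal H=\{\gamma\in\Delta^+\mid(\gamma,\theta)>0\}$. An upper ideal of $\Delta^+$ is $I\subset\Delta^+$ with $\gamma\in I,\nu\in\Delta^+,\nu+\gamma\in\Delta^+\Rightarrow\nu+\gamma\in I$; it is abelian if $\gamma'+\gamma''\notin\Delta^+$ for all $\gamma',\gamma''\in I$. For $w\in W$, $N(w)=\{\gamma\in\Delta^+\mid w(\gamma)\in-\Delta^+\}$. For $\mu\in\Delta^+_l$, let $w_\mu$ be the unique element of minimal length in $W$ with $w_\mu(\theta)=\mu$, and set $I(\mu)_{\sf min}=\{\theta\}\cup\{\theta-\gamma\mid\gamma\in N(w_\mu)\}$; this is an abelian upper ideal contained in $\mathcal H$. It is known that among nonempty abelian upper ideals $I$ with $I\cap\mathcal H=I(\mu)_{\sf min}$ there is a unique maximal one, denoted $I(\mu)_{\sf max}$; the ideals $I(\alpha)_{\sf max}$, $\alpha\in\Pi_l$, are exactly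 the maximal abelian upper ideals of $\Delta^+$. *)

theory Defs
  imports "HOL-Analysis.Analysis"
begin

definition root_refl :: "'a::euclidean_space \<Rightarrow> 'a \<Rightarrow> 'a" where
  "root_refl \<alpha> x = x - ((2 * (x \<bullet> \<alpha>)) / (\<alpha> \<bullet> \<alpha>)) *\<^sub>R \<alpha>"

definition root_system :: "'a::euclidean_space set \<Rightarrow> bool" where
  "root_system R \<longleftrightarrow> finite R \<and> 0 \<notin> R \<and> span R = UNIV \<and>
     (\<forall>\<alpha>\<in>R. \<forall>\<beta>\<in>R. root_refl \<alpha> \<beta> \<in> R) \<and>
     (\<forall>\<alpha>\<in>R. \<forall>\<beta>\<in>R. (2 * (\<beta> \<bullet> \<alpha>)) / (\<alpha> \<bullet> \<alpha>) \<in> \<int>)"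

definition reduced_rs :: "'a::euclidean_space set \<Rightarrow> bool" where
  "reduced_rs R \<longleftrightarrow> (\<forall>\<alpha>\<in>R. \<forall>c::real. c *\<^sub>R \<alpha> \<in> R \<longrightarrow> c = 1 \<or> c = -1)"

definition irreducible_rs :: "'a::euclidean_space set \<Rightarrow> bool" where
  "irreducible_rs R \<longleftrightarrow> R \<noteq> {} \<and>
     \<not> (\<exists>R1 R2. R1 \<noteq> {} \<and> R2 \<noteq> {} \<and> R1 \<union> R2 = R \<and> R1 \<inter> R2 = {} \<and>
               (\<forall>\<alpha>\<in>R1. \<forall>\<beta>\<in>R2. \<alpha> \<bullet> \<beta> = 0))"

definition nonneg_int_comb :: "'a::euclidean_space set \<Rightarrow> 'a \<Rightarrow> bool" where
  "nonneg_int_comb B v \<longleftrightarrow> (\<exists>c::'a \<Rightarrow> nat. v = (\<Sum>\<alpha>\<in>B. real (c \<alpha>) *\<^sub>R \<alpha>))"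

definition is_base :: "'a::euclidean_space set \<Rightarrow> 'a set \<Rightarrow> bool" where
  "is_base R B \<longleftrightarrow> B \<subseteq> R \<and> independent B \<and>
     (\<forall>\<gamma>\<in>R. nonneg_int_comb B \<gamma> \<or> nonneg_int_comb B (- \<gamma>))"

definition pos_roots :: "'a::euclidean_space set \<Rightarrow> 'a set \<Rightarrow> 'a set" where
  "pos_roots R B = {\<gamma>\<in>R. nonneg_int_comb B \<gamma>}"

definition root_le :: "'a::euclidean_space set \<Rightarrow> 'a \<Rightarrow> 'a \<Rightarrow> bool" where
  "root_le B \<mu> \<nu> \<longleftrightarrow> nonneg_int_comb B (\<nu> - \<mu>)"

definition highest_root :: "'a::euclidean_space set \<Rightarrow> 'a set \<Rightarrow> 'a" where
  "highest_root R B = (THE \<theta>. \<theta> \<in> pos_roots R B \<and> (\<forall>\<gamma>\<in>pos_roots R B. root_le B \<gamma> \<theta>))"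

definition long_roots :: "'a::euclidean_space set \<Rightarrow> 'a set" where
  "long_roots R = {\<gamma>\<in>R. \<forall>\<beta>\<in>R. \<beta> \<bullet> \<beta> \<le> \<gamma> \<bullet> \<gamma>}"

definition long_pos_roots :: "'a::euclidean_space set \<Rightarrow> 'a set \<Rightarrow> 'a set" where
  "long_pos_roots R B = pos_roots R B \<inter> long_roots R"

definition long_simple_roots :: "'a::euclidean_space set \<Rightarrow> 'a set \<Rightarrow> 'a set" where
  "long_simple_roots R B = B \<inter> long_roots R"

text \<open>Type A: all roots of the same length (simply-laced) and the Dynkin diagram
  (simple roots, edges between non-orthogonal distinct simple roots) has no vertex
  of degree \<ge> 3. For irreducible R this is exactly type A_n.\<close>
definition type_A :: "'a::euclidean_space set \<Rightarrow> 'a set \<Rightarrow> bool" where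
  "type_A R B \<longleftrightarrow> (\<forall>\<alpha>\<in>R. \<forall>\<beta>\<in>R. \<alpha> \<bullet> \<alpha> = \<beta> \<bullet> \<beta>) \<and>
     (\<forall>\<alpha>\<in>B. card {\<beta>\<in>B. \<beta> \<noteq> \<alpha> \<and> \<alpha> \<bullet> \<beta> \<noteq> 0} \<le> 2)"

inductive_set weyl_group :: "'a::euclidean_space set \<Rightarrow> ('a \<Rightarrow> 'a) set" for R where
  weyl_id: "id \<in> weyl_group R"
| weyl_step: "w \<in> weyl_group R \<Longrightarrow> \<alpha> \<in> R \<Longrightarrow> root_refl \<alpha> \<circ> w \<in> weyl_group R"

definition weyl_length :: "'a::euclidean_space set \<Rightarrow> ('a \<Rightarrow> 'a) \<Rightarrow> nat" where
  "weyl_length B w = (LEAST n. \<exists>xs. set xs \<subseteq> B \<and> length xs = n \<and> w = foldr (\<lambda>\<alpha> f. root_refl \<alpha> \<circ> f) xs id)"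

definition inv_set :: "'a::euclidean_space set \<Rightarrow> 'a set \<Rightarrow> ('a \<Rightarrow> 'a) \<Rightarrow> 'a set" where
  "inv_set R B w = {\<gamma>\<in>pos_roots R B. w \<gamma> \<in> uminus ` pos_roots R B}"

definition w_of :: "'a::euclidean_space set \<Rightarrow> 'a set \<Rightarrow> 'a \<Rightarrow> ('a \<Rightarrow> 'a)" where
  "w_of R B \<mu> = (THE w. w \<in> weyl_group R \<and> w (highest_root R B) = \<mu> \<and>
      (\<forall>w'\<in>weyl_group R. w' (highest_root R B) = \<mu> \<longrightarrow> weyl_length B w \<le> weyl_length B w'))"

definition H_set :: "'a::euclidean_space set \<Rightarrow> 'a set \<Rightarrow> 'a set" where
  "H_set R B = {\<gamma>\<in>pos_roots R B. \<gamma> \<bullet> highest_root R B > 0}"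

definition upper_ideal :: "'a::euclidean_space set \<Rightarrow> 'a set \<Rightarrow> 'a set \<Rightarrow> bool" where
  "upper_ideal R B I \<longleftrightarrow> I \<subseteq> pos_roots R B \<and>
     (\<forall>\<gamma>\<in>I. \<forall>\<nu>\<in>pos_roots R B. \<nu> + \<gamma> \<in> pos_roots R B \<longrightarrow> \<nu> + \<gamma> \<in> I)"

definition abelian_ideal :: "'a::euclidean_space set \<Rightarrow> 'a set \<Rightarrow> 'a set \<Rightarrow> bool" where
  "abelian_ideal R B I \<longleftrightarrow> upper_ideal R B I \<and>
     (\<forall>\<gamma>1\<in>I. \<forall>\<gamma>2\<in>I. \<gamma>1 + \<gamma>2 \<notin> pos_roots R B)"

definition I_min :: "'a::euclidean_space set \<Rightarrow> 'a set \<Rightarrow> 'a \<Rightarrow> 'a set" where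
  "I_min R B \<mu> = insert (highest_root R B)
      {highest_root R B - \<gamma> | \<gamma>. \<gamma> \<in> inv_set R B (w_of R B \<mu>)}"

text \<open>The unique maximal (equivalently, greatest, by finiteness) nonempty abelian upper
  ideal I with I \<inter> H = I(\<mu>)_min.\<close>
definition I_max :: "'a::euclidean_space set \<Rightarrow> 'a set \<Rightarrow> 'a \<Rightarrow> 'a set" where
  "I_max R B \<mu> = (THE I. I \<noteq> {} \<and> abelian_ideal R B I \<and> I \<inter> H_set R B = I_min R B \<mu> \<and>
      (\<forall>J. J \<noteq> {} \<and> abelian_ideal R B J \<and> J \<inter> H_set R B = I_min R B \<mu> \<longrightarrow> J \<subseteq> I))"

end

theory Submission
  imports Defs
begin

text \<open>For a long simple root \<open>\<alpha>\<close> put \<open>w = w\<^sub>\<alpha>\<close>. Then \<open>I(\<alpha>)\<^sub>m\<^sub>i\<^sub>n\<close> consists of the \<open>\<gamma> \<in> \<H>\<close>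
  with \<open>w \<gamma> > 0\<close>, and \<open>I(\<alpha>)\<^sub>m\<^sub>a\<^sub>x\<close> is simply the set of all positive roots \<open>\<gamma>\<close> such that every
  element of \<open>\<H>\<close> above \<open>\<gamma>\<close> lies in \<open>I(\<alpha>)\<^sub>m\<^sub>i\<^sub>n\<close>. The only point at issue is that this set is
  abelian: its elements \<open>\<gamma>\<close> orthogonal to \<open>\<theta>\<close> have the property that \<open>w \<gamma>\<close> and \<open>\<theta>\<close> have the same
  coefficients at \<open>\<alpha>\<close> and its neighbours, so sums of two elements would exceed \<open>\<theta>\<close>.
  Outside type A exactly one simple root is not orthogonal to \<open>\<theta>\<close>. As the Dynkin diagram is a
  forest, the elements of \<open>\<H>\<close> above a given \<open>\<gamma>\<close> then have a least one, \<open>\<epsilon>\<close>. If \<open>\<gamma>\<close> lies outside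
  all \<open>I(\<alpha>)\<^sub>m\<^sub>a\<^sub>x\<close> with \<open>\<alpha> \<in> S\<close>, so does \<open>\<epsilon>\<close>, and maximality gives \<open>\<gamma> = \<epsilon> \<in> \<H>\<close>.\<close>

section \<open>Naturals inside the reals and the algebra of a single reflection\<close>

lemma Nats_real_nonneg: "(x::real) \<in> \<nat> \<Longrightarrow> x \<ge> 0"
  by (auto elim!: Nats_cases)

lemma sum_real_in_Nats: "(\<And>a. a \<in> A \<Longrightarrow> f a \<in> \<nat>) \<Longrightarrow> (\<Sum>a\<in>A. f a) \<in> (\<nat> :: real set)"
  by (induction A rule: infinite_finite_induct) auto

lemma finite_real_max_ex:
  fixes f :: "'b \<Rightarrow> real"
  assumes "finite A" "A \<noteq> {}" shows "\<exists>m\<in>A. \<forall>x\<in>A. f x \<le> f m"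
proof -
  have "Max (f ` A) \<in> f ` A" using assms by (intro Max_in) auto
  then obtain m where "m \<in> A" "Max (f ` A) = f m" by auto
  then show ?thesis using assms by (metis Max_ge finite_imageI imageI)
qed

lemma root_refl_linear: "linear (root_refl a)"
  by (rule linearI) (simp_all add: root_refl_def inner_add_left algebra_simps add_divide_distrib)

lemma root_refl_inner: "root_refl a x \<bullet> root_refl a y = x \<bullet> y"
proof (cases "a = 0")
  case False
  then have "a \<bullet> a \<noteq> 0" by simp
  then show ?thesis
    by (simp add: root_refl_def inner_diff_left inner_diff_right field_simps inner_commute)
qed (simp add: root_refl_def)

lemma root_refl_self: "root_refl a a = - a"
  by (cases "a = 0") (simp_all add: root_refl_def scaleR_2)

lemma root_refl_orth: "x \<bullet> a = 0 \<Longrightarrow> root_refl a x = x"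
  by (simp add: root_refl_def)

lemma root_refl_uminus: "root_refl (- a) = root_refl a"
  by (rule ext) (simp add: root_refl_def)

lemma root_refl_involution: "root_refl a (root_refl a x) = x"
proof -
  have "root_refl a (root_refl a x)
      = root_refl a (x - ((2 * (x \<bullet> a)) / (a \<bullet> a)) *\<^sub>R a)"
    by (simp add: root_refl_def[of a x])
  also have "\<dots> = root_refl a x + ((2 * (x \<bullet> a)) / (a \<bullet> a)) *\<^sub>R a"
    by (simp add: linear_diff[OF root_refl_linear] linear_scale[OF root_refl_linear] root_refl_self)
  finally show ?thesis by (simp add: root_refl_def)
qed

lemma root_refl_conj:
  assumes "linear f" and "\<And>x y. f x \<bullet> f y = x \<bullet> y"
  shows "root_refl (f a) (f x) = f (root_refl a x)"
  using assms by (simp add: root_refl_def linear_diff linear_scale)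

section \<open>Words in reflections\<close>

definition refl_word :: "'a::euclidean_space list \<Rightarrow> 'a \<Rightarrow> 'a" where
  "refl_word xs = foldr (\<lambda>a f. root_refl a \<circ> f) xs id"

lemma refl_word_Nil [simp]: "refl_word [] = id"
  and refl_word_Cons [simp]: "refl_word (a # xs) = root_refl a \<circ> refl_word xs"
  by (simp_all add: refl_word_def)

lemma refl_word_append: "refl_word (xs @ ys) = refl_word xs \<circ> refl_word ys"
  by (induction xs) auto

lemma refl_word_linear: "linear (refl_word xs)"
  by (induction xs)
    (simp_all only: refl_word_Nil refl_word_Cons linear_id linear_compose root_refl_linear)

lemma refl_word_inner: "refl_word xs x \<bullet> refl_word xs y = x \<bullet> y"
  by (induction xs) (auto simp: root_refl_inner)

lemma refl_word_rev: "refl_word (rev xs) (refl_word xs x) = x"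
  by (induction xs arbitrary: x) (auto simp: refl_word_append root_refl_involution)

lemma refl_word_rev': "refl_word xs (refl_word (rev xs) x) = x"
  using refl_word_rev[of "rev xs" x] by simp

section \<open>Cartan integers, sums and differences of two roots\<close>

locale based_root_system =
  fixes R B :: "'a::euclidean_space set"
  assumes root_sys: "root_system R"
    and reduced: "reduced_rs R"
    and irreducible: "irreducible_rs R"
    and base: "is_base R B"
begin

lemma finite_R: "finite R" and zero_notin_R: "0 \<notin> R" and span_R: "span R = UNIV"
  and refl_in_R: "\<lbrakk>a \<in> R; x \<in> R\<rbrakk> \<Longrightarrow> root_refl a x \<in> R"
  and cartan_int: "\<lbrakk>a \<in> R; x \<in> R\<rbrakk> \<Longrightarrow> (2 * (x \<bullet> a)) / (a \<bullet> a) \<in> \<int>"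
  using root_sys by (auto simp: root_system_def)

lemma R_uminus: "a \<in> R \<Longrightarrow> - a \<in> R"
  using refl_in_R[of a a] by (simp add: root_refl_self)

lemma root_pos: "a \<in> R \<Longrightarrow> a \<bullet> a > 0"
  using zero_notin_R by auto

text \<open>Cauchy-Schwarz is strict here, because proportional roots of a reduced system are equal
  or opposite. The vector \<open>x - c *\<^sub>R a\<close> is the component of \<open>x\<close>
  orthogonal to \<open>a\<close>.\<close>

lemma cartan_prod_less_4:
  assumes "a \<in> R" "x \<in> R" "x \<noteq> a" "x \<noteq> - a"
  shows "((2 * (x \<bullet> a)) / (a \<bullet> a)) * ((2 * (a \<bullet> x)) / (x \<bullet> x)) < 4"
proof -
  define c where "c = (x \<bullet> a) / (a \<bullet> a)"
  have a: "a \<bullet> a > 0" and x: "x \<bullet> x > 0" using assms root_pos by auto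
  have "x - c *\<^sub>R a \<noteq> 0"
  proof
    assume "x - c *\<^sub>R a = 0"
    then have "x = c *\<^sub>R a" by simp
    with reduced assms have "c = 1 \<or> c = -1" by (auto simp: reduced_rs_def)
    with \<open>x = c *\<^sub>R a\<close> assms show False by auto
  qed
  then have "(x - c *\<^sub>R a) \<bullet> (x - c *\<^sub>R a) > 0" by simp
  also have "(x - c *\<^sub>R a) \<bullet> (x - c *\<^sub>R a) = x \<bullet> x - (x \<bullet> a)^2 / (a \<bullet> a)"
    using a by (simp add: c_def inner_diff_left inner_diff_right inner_commute power2_eq_square field_simps)
  finally have "(x \<bullet> a)^2 < (a \<bullet> a) * (x \<bullet> x)" using a by (simp add: field_simps)
  then show ?thesis using a x by (simp add: field_simps power2_eq_square inner_commute)
qed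

text \<open>Both Cartan integers are positive with product below 4, so one of them is 1, and the
  corresponding reflection produces the difference up to sign.\<close>

lemma sub_root:
  assumes "a \<in> R" "x \<in> R" "a \<bullet> x > 0" "a \<noteq> x"
  shows "a - x \<in> R"
proof -
  have a: "a \<bullet> a > 0" and x: "x \<bullet> x > 0" using assms root_pos by auto
  obtain m n where m: "(2 * (x \<bullet> a)) / (a \<bullet> a) = of_int m" and n: "(2 * (a \<bullet> x)) / (x \<bullet> x) = of_int n"
    using cartan_int assms by (metis Ints_cases)
  have "real_of_int m > 0" "real_of_int n > 0"
    unfolding m[symmetric] n[symmetric] using a x assms by (auto simp: inner_commute)
  then have pos: "m > 0" "n > 0" by simp_all
  have "x \<noteq> - a" using assms(3) a by (auto simp del: inner_gt_zero_iff)
  then have "real_of_int m * real_of_int n < 4"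
    using cartan_prod_less_4[of a x] assms unfolding m n by auto
  then have "real_of_int (m * n) < real_of_int 4" by simp
  then have mn: "m * n < 4" by (simp only: of_int_less_iff)
  have "m = 1 \<or> n = 1"
  proof (rule ccontr)
    assume "\<not> ?thesis"
    then have "m \<ge> 2" "n \<ge> 2" using pos by auto
    then have "2 * 2 \<le> m * n" by (intro mult_mono) auto
    then show False using mn by simp
  qed
  then show ?thesis
  proof
    assume "m = 1"
    then have "x - a \<in> R" using refl_in_R[of a x] assms m by (simp add: root_refl_def)
    then show ?thesis using R_uminus by fastforce
  next
    assume "n = 1"
    then show ?thesis using refl_in_R[of x a] assms n by (simp add: root_refl_def)
  qed
qed

lemma add_root: "\<lbrakk>a \<in> R; x \<in> R; a \<bullet> x < 0; a \<noteq> - x\<rbrakk> \<Longrightarrow> a + x \<in> R"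
  using sub_root[of a "- x"] R_uminus by simp

text \<open>The product of the two Cartan integers is a positive integer, hence at least 1: the
  cosine between non-orthogonal roots has absolute value at least 1/2.\<close>

lemma cartan_prod_ge_1:
  assumes "a \<in> R" "x \<in> R" "a \<bullet> x \<noteq> 0"
  shows "(a \<bullet> a) * (x \<bullet> x) \<le> 4 * (a \<bullet> x)^2"
proof -
  have a: "a \<bullet> a > 0" and x: "x \<bullet> x > 0" using assms root_pos by auto
  obtain m n where m: "(2 * (x \<bullet> a)) / (a \<bullet> a) = of_int m" and n: "(2 * (a \<bullet> x)) / (x \<bullet> x) = of_int n"
    using cartan_int assms by (metis Ints_cases)
  have "real_of_int (m * n) = (2 * (x \<bullet> a)) / (a \<bullet> a) * ((2 * (a \<bullet> x)) / (x \<bullet> x))"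
    by (simp add: m n)
  also have "\<dots> = 4 * (a \<bullet> x)^2 / ((a \<bullet> a) * (x \<bullet> x))"
    by (simp add: power2_eq_square inner_commute)
  finally have eq: "real_of_int (m * n) = 4 * (a \<bullet> x)^2 / ((a \<bullet> a) * (x \<bullet> x))" .
  then have "real_of_int (m * n) > 0" using a x assms by simp
  then have "m * n \<ge> 1" by (simp only: of_int_0_less_iff)
  then have "1 \<le> real_of_int (m * n)" by (simp only: of_int_1_le_iff)
  then show ?thesis using a x unfolding eq by (simp add: field_simps)
qed

text \<open>The ratio of squared lengths is n / m, at most m n < 4 because m is a nonzero integer.
  This later rules out adjacent simple roots whose norms differ by a factor of 2 or more.\<close>

lemma length_ratio:
  assumes "a \<in> R" "x \<in> R" "a \<bullet> x \<noteq> 0" "a \<noteq> x" "a \<noteq> - x"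
  shows "a \<bullet> a < 4 * (x \<bullet> x)"
proof -
  have a: "a \<bullet> a > 0" and x: "x \<bullet> x > 0" using assms root_pos by auto
  define m where "m = (2 * (x \<bullet> a)) / (a \<bullet> a)"
  define n where "n = (2 * (a \<bullet> x)) / (x \<bullet> x)"
  have mn: "m * n < 4" unfolding m_def n_def using assms by (intro cartan_prod_less_4) auto
  have "m \<in> \<int>" unfolding m_def using assms cartan_int by auto
  moreover have "m \<noteq> 0" using assms a by (simp add: m_def inner_commute)
  ultimately have "\<bar>m\<bar> \<ge> 1" by (rule Ints_nonzero_abs_ge1)
  then have m1: "m * m \<ge> 1" by (metis abs_le_square_iff abs_one mult_1 power2_eq_square)
  have r: "n * (x \<bullet> x) = m * (a \<bullet> a)" using a x by (simp add: m_def n_def inner_commute)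
  have "a \<bullet> a \<le> (m * m) * (a \<bullet> a)" using m1 a by simp
  also have "\<dots> = (m * n) * (x \<bullet> x)" by (simp only: mult.assoc r[symmetric])
  also have "\<dots> < 4 * (x \<bullet> x)" using mn x by simp
  finally show ?thesis .
qed

subsection \<open>Coordinates with respect to the base\<close>

abbreviation P where "P \<equiv> pos_roots R B"

abbreviation cf :: "'a \<Rightarrow> 'a \<Rightarrow> real" where "cf \<equiv> representation B"

lemma B_sub_R: "B \<subseteq> R" and indep_B: "independent B"
  and pos_or_neg_comb: "x \<in> R \<Longrightarrow> nonneg_int_comb B x \<or> nonneg_int_comb B (- x)"
  using base by (auto simp: is_base_def)

lemma B_in_R: "b \<in> B \<Longrightarrow> b \<in> R" using B_sub_R by auto

lemma finite_B: "finite B" using B_sub_R finite_R finite_subset by blast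

lemma nonneg_int_comb_span: "nonneg_int_comb B x \<Longrightarrow> x \<in> span B"
  by (auto simp: nonneg_int_comb_def intro: span_sum span_scale span_base)

lemma span_B: "span B = UNIV"
proof -
  have "x \<in> span B" if "x \<in> R" for x
    using pos_or_neg_comb[OF that] nonneg_int_comb_span span_neg[of "- x" B] by fastforce
  then have "span R \<subseteq> span B" using span_mono[of R "span B"] span_span by blast
  then show ?thesis using span_R by auto
qed

lemma cf_expand: "(\<Sum>b\<in>B. cf x b *\<^sub>R b) = x"
  by (rule sum_representation_eq) (auto simp: indep_B span_B finite_B)

lemma cf_add: "cf (x + y) b = cf x b + cf y b"
  and cf_diff: "cf (x - y) b = cf x b - cf y b"
  and cf_neg: "cf (- x) b = - cf x b"
  and cf_scale: "cf (k *\<^sub>R x) b = k * cf x b"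
  by (simp_all add: representation_add representation_diff representation_neg representation_scale indep_B span_B)

lemma cf_base: "b \<in> B \<Longrightarrow> cf b c = (if c = b then 1 else 0)"
  by (auto simp: representation_basis[OF indep_B])

lemma cf_eq: "(\<And>b. b \<in> B \<Longrightarrow> cf x b = cf y b) \<Longrightarrow> x = y"
  using cf_expand[of x] cf_expand[of y] by (metis (mono_tags, lifting) sum.cong)

lemma cf_sum_base:
  assumes "c \<in> B" shows "cf (\<Sum>b\<in>B. k b *\<^sub>R b) c = k c"
proof -
  have "cf (\<Sum>b\<in>B. k b *\<^sub>R b) c = (\<Sum>b\<in>B. cf (k b *\<^sub>R b) c)"
    by (subst representation_sum[OF indep_B]) (auto simp: span_B)
  also have "\<dots> = (\<Sum>b\<in>B. if b = c then k b else 0)"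
    by (intro sum.cong) (auto simp: cf_scale cf_base)
  finally show ?thesis using assms finite_B by simp
qed

lemma inner_expand: "x \<bullet> y = (\<Sum>b\<in>B. cf x b * (b \<bullet> y))"
  by (subst (1) cf_expand[of x, symmetric]) (simp only: inner_sum_left inner_scaleR_left)

lemma nonneg_int_comb_iff: "nonneg_int_comb B x \<longleftrightarrow> (\<forall>b\<in>B. cf x b \<in> \<nat>)"
proof
  assume "nonneg_int_comb B x"
  then show "\<forall>b\<in>B. cf x b \<in> \<nat>"
    by (auto simp: nonneg_int_comb_def cf_sum_base)
next
  assume nat: "\<forall>b\<in>B. cf x b \<in> \<nat>"
  have "x = (\<Sum>b\<in>B. real (nat \<lfloor>cf x b\<rfloor>) *\<^sub>R b)"
    by (subst cf_expand[of x, symmetric], rule sum.cong) (use nat in \<open>auto elim!: Nats_cases\<close>)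
  then show "nonneg_int_comb B x" unfolding nonneg_int_comb_def
    by (rule exI[of _ "\<lambda>b. nat \<lfloor>cf x b\<rfloor>"])
qed

lemma P_iff: "x \<in> P \<longleftrightarrow> x \<in> R \<and> (\<forall>b\<in>B. cf x b \<in> \<nat>)"
  by (simp add: pos_roots_def nonneg_int_comb_iff)

lemma P_in_R: "x \<in> P \<Longrightarrow> x \<in> R" by (simp add: P_iff)

lemma P_cf_nat: "\<lbrakk>x \<in> P; b \<in> B\<rbrakk> \<Longrightarrow> cf x b \<in> \<nat>" by (simp add: P_iff)

lemma P_cf_nonneg: "\<lbrakk>x \<in> P; b \<in> B\<rbrakk> \<Longrightarrow> cf x b \<ge> 0" using P_cf_nat Nats_real_nonneg by blast

lemma finite_P: "finite P" using finite_R by (simp add: pos_roots_def)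

lemma root_cf_int: "\<lbrakk>x \<in> R; b \<in> B\<rbrakk> \<Longrightarrow> cf x b \<in> \<int>"
  using pos_or_neg_comb[of x] unfolding nonneg_int_comb_iff cf_neg
  by (metis Ints_minus Nats_subset_Ints add.inverse_inverse subsetD)

lemma R_cases: "x \<in> R \<Longrightarrow> x \<in> P \<or> - x \<in> P"
  using pos_or_neg_comb[of x] R_uminus by (auto simp: pos_roots_def)

lemma root_le_iff: "root_le B x y \<longleftrightarrow> (\<forall>b\<in>B. cf y b - cf x b \<in> \<nat>)"
  by (simp add: root_le_def nonneg_int_comb_iff cf_diff)

text \<open>Coordinates of roots are integers, so the integrality demanded by \<open>root_le\<close>
  is automatic between roots.\<close>

lemma root_le_iff_cf:
  assumes "x \<in> R" "y \<in> R" shows "root_le B x y \<longleftrightarrow> (\<forall>b\<in>B. cf x b \<le> cf y b)"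
proof -
  have "cf y b - cf x b \<in> \<nat> \<longleftrightarrow> cf x b \<le> cf y b" if "b \<in> B" for b
  proof -
    have "cf y b - cf x b \<in> \<int>" using root_cf_int that assms by auto
    then show ?thesis by (auto simp: Nats_altdef2)
  qed
  then show ?thesis by (auto simp: root_le_iff)
qed

lemma P_iff_cf: "x \<in> P \<longleftrightarrow> x \<in> R \<and> (\<forall>b\<in>B. cf x b \<ge> 0)"
  using root_cf_int P_iff by (auto simp: Nats_altdef2)

lemma B_in_P: "b \<in> B \<Longrightarrow> b \<in> P"
  using B_in_R by (auto simp: P_iff_cf cf_base)

lemma P_not_neg: "x \<in> P \<Longrightarrow> - x \<notin> P"
proof
  assume "x \<in> P" "- x \<in> P"
  then have "cf x b = cf 0 b" if "b \<in> B" for b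
    using that by (force simp: P_iff_cf cf_neg representation_zero)
  then have "x = 0" by (rule cf_eq)
  then show False using \<open>x \<in> P\<close> zero_notin_R P_in_R by auto
qed

text \<open>The coordinates of a root share one sign, so a single positive one decides.\<close>

lemma P_if_cf_pos: "\<lbrakk>x \<in> R; b \<in> B; cf x b > 0\<rbrakk> \<Longrightarrow> x \<in> P"
  using R_cases[of x] by (force simp: P_iff_cf cf_neg)

lemma P_cf_pos_ex: assumes "x \<in> P" shows "\<exists>b\<in>B. cf x b > 0"
proof (rule ccontr)
  assume "\<not> ?thesis"
  then have "- x \<in> P" using assms R_uminus by (auto simp: P_iff_cf cf_neg not_less)
  then show False using P_not_neg assms by auto
qed

lemma P_cf_ge1: "\<lbrakk>x \<in> P; b \<in> B; cf x b > 0\<rbrakk> \<Longrightarrow> cf x b \<ge> 1"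
  using P_cf_nat[of x b] by (auto elim!: Nats_cases)

lemma base_inner_nonpos: assumes "a \<in> B" "b \<in> B" "a \<noteq> b" shows "a \<bullet> b \<le> 0"
proof (rule ccontr)
  assume "\<not> ?thesis"
  then have r: "a - b \<in> R" using assms B_in_R by (intro sub_root) auto
  then have "a - b \<in> P" using assms by (intro P_if_cf_pos[of _ a]) (auto simp: cf_diff cf_base)
  then show False using P_cf_nonneg[of "a - b" b] assms by (auto simp: cf_diff cf_base)
qed

section \<open>The root order, heights, and induction along simple steps\<close>

lemma root_le_refl: "root_le B x x" by (simp add: root_le_iff)

lemma root_le_trans: "\<lbrakk>root_le B x y; root_le B y z\<rbrakk> \<Longrightarrow> root_le B x z"
proof -
  assume a: "root_le B x y" "root_le B y z"
  have "cf z b - cf x b \<in> \<nat>" if "b \<in> B" for b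
    using Nats_add[of "cf y b - cf x b" "cf z b - cf y b"] a that by (auto simp: root_le_iff)
  then show ?thesis by (auto simp: root_le_iff)
qed

lemma root_le_add: "y \<in> P \<Longrightarrow> root_le B x (x + y)"
  using P_cf_nat by (auto simp: root_le_iff cf_add)

lemma root_le_antisym: "\<lbrakk>root_le B x y; root_le B y x\<rbrakk> \<Longrightarrow> x = y"
proof (rule cf_eq)
  fix b assume "root_le B x y" "root_le B y x" "b \<in> B"
  then have "cf y b - cf x b \<in> \<nat>" "cf x b - cf y b \<in> \<nat>" by (auto simp: root_le_iff)
  then show "cf x b = cf y b" by (auto dest!: Nats_real_nonneg)
qed

lemma root_ge_P: "\<lbrakk>x \<in> P; y \<in> R; root_le B x y\<rbrakk> \<Longrightarrow> y \<in> P"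
  using P_cf_nonneg[of x] by (force simp: P_iff_cf root_le_iff_cf)

definition ht :: "'a \<Rightarrow> real" where "ht x = (\<Sum>b\<in>B. cf x b)"

lemma ht_add: "ht (x + y) = ht x + ht y" and ht_diff: "ht (x - y) = ht x - ht y"
  and ht_scale: "ht (k *\<^sub>R x) = k * ht x"
  by (simp_all add: ht_def cf_add cf_diff cf_scale sum.distrib sum_subtractf sum_distrib_left)

lemma ht_base: "b \<in> B \<Longrightarrow> ht b = 1"
  using finite_B by (simp add: ht_def cf_base)

lemma ht_nat: "nonneg_int_comb B x \<Longrightarrow> ht x \<in> \<nat>"
  unfolding ht_def nonneg_int_comb_iff by (rule sum_real_in_Nats) auto

lemma ht_mono: "root_le B x y \<Longrightarrow> ht x \<le> ht y"
  using ht_nat[of "y - x"] Nats_real_nonneg by (fastforce simp: root_le_def ht_diff)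

lemma ht_P_ge1: "x \<in> P \<Longrightarrow> ht x \<ge> 1"
proof -
  assume x: "x \<in> P"
  then obtain b where b: "b \<in> B" "cf x b > 0" using P_cf_pos_ex by auto
  have "1 \<le> cf x b" using P_cf_ge1 x b by auto
  also have "\<dots> \<le> ht x" unfolding ht_def
    using member_le_sum[OF b(1), of "cf x"] P_cf_nonneg x finite_B by auto
  finally show ?thesis .
qed

text \<open>Since \<open>y - x\<close> has positive norm, some simple \<open>b\<close> occurs in it
  with positive coefficient and pairs positively with it. Then \<open>b\<close> pairs positively
  with \<open>y\<close> or negatively with \<open>x\<close>, so it can be removed at the upper end
  or added at the lower end.\<close>

lemma root_le_step:
  assumes x: "x \<in> P" and y: "y \<in> P" and le: "root_le B x y" and ne: "x \<noteq> y"
  shows "(\<exists>b\<in>B. y - b \<in> P \<and> root_le B x (y - b)) \<or> (\<exists>b\<in>B. x + b \<in> P \<and> root_le B (x + b) y)"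
proof -
  define k where "k = y - x"
  have cfk: "cf k b \<in> \<nat>" if "b \<in> B" for b
    using le that by (simp add: root_le_iff k_def cf_diff)
  have "k \<bullet> k > 0" using ne by (simp add: k_def)
  then have "(\<Sum>b\<in>B. cf k b * (b \<bullet> k)) > 0" using inner_expand[of k k] by simp
  then obtain b where b: "b \<in> B" and prod: "cf k b * (b \<bullet> k) > 0"
    by (meson not_less sum_nonpos)
  have "cf k b \<ge> 0" using cfk b Nats_real_nonneg by auto
  then have kb: "cf k b > 0" "b \<bullet> k > 0" using prod by (auto simp: zero_less_mult_iff)
  then have kb1: "cf k b \<ge> 1" using cfk[OF b] by (auto elim!: Nats_cases)
  have lo: "cf k c \<ge> (if c = b then 1 else 0)" if "c \<in> B" for c
    using kb1 cfk[OF that] Nats_real_nonneg by auto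
  have cy: "cf y c = cf x c + cf k c" for c by (simp add: k_def cf_diff)
  have "y \<bullet> b > 0 \<or> x \<bullet> b < 0" using kb(2) by (auto simp: k_def inner_diff_right inner_commute)
  then show ?thesis
  proof
    assume yb: "y \<bullet> b > 0"
    have "y \<noteq> b"
    proof
      assume yb': "y = b"
      have "cf x c \<le> 0" if "c \<in> B" for c
        using lo[OF that] cy[of c] that b unfolding yb' by (auto simp: cf_base split: if_splits)
      then show False using P_cf_pos_ex[OF x] by force
    qed
    then have r: "y - b \<in> R" using yb y b P_in_R B_in_R by (intro sub_root) auto
    have "root_le B x (y - b)"
      using lo b by (subst root_le_iff_cf) (auto simp: r x P_in_R cf_diff cf_base cy)
    then show ?thesis using root_ge_P[OF x r] b by auto
  next
    assume xb: "x \<bullet> b < 0"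
    have "x \<noteq> - b" using x b B_in_P P_not_neg by auto
    then have r: "x + b \<in> R" using xb x b P_in_R B_in_R by (intro add_root) auto
    have "root_le B (x + b) y"
      using lo b by (subst root_le_iff_cf) (auto simp: r y P_in_R cf_add cf_base cy)
    moreover have "x + b \<in> P" using root_ge_P[OF x r] root_le_add[OF B_in_P[OF b]] by auto
    ultimately show ?thesis using b by auto
  qed
qed

text \<open>\<open>root_le_step\<close> does not let one choose the end at which the gap shrinks, so
  both kinds of step are premises. The measure is the height of the gap.\<close>

lemma root_le_induct:
  assumes "root_le B x y" "x \<in> P" "y \<in> P"
    and "\<And>y. y \<in> P \<Longrightarrow> Q y y"
    and "\<And>x y b. \<lbrakk>x \<in> P; y \<in> P; b \<in> B; y - b \<in> P; root_le B x (y - b); Q x (y - b)\<rbrakk> \<Longrightarrow> Q x y"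
    and "\<And>x y b. \<lbrakk>x \<in> P; y \<in> P; b \<in> B; x + b \<in> P; root_le B (x + b) y; Q (x + b) y\<rbrakk> \<Longrightarrow> Q x y"
  shows "Q x y"
  using assms(1-3)
proof (induction "nat \<lfloor>ht (y - x)\<rfloor>" arbitrary: x y rule: less_induct)
  case less
  show ?case
  proof (cases "x = y")
    case False
    have nat: "ht (y - x) \<in> \<nat>" using less.prems(1) ht_nat by (simp add: root_le_def)
    have *: "nat \<lfloor>ht (v - u)\<rfloor> < nat \<lfloor>ht (y - x)\<rfloor>" if "ht (v - u) = ht (y - x) - 1" "root_le B u v" for u v
    proof -
      have "ht (v - u) \<in> \<nat>" using that(2) ht_nat by (simp add: root_le_def)
      then show ?thesis using that(1) nat by (auto elim!: Nats_cases)
    qed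
    from root_le_step[OF less.prems(2,3,1) False] show ?thesis
    proof (elim disjE bexE conjE)
      fix b assume b: "b \<in> B" "y - b \<in> P" "root_le B x (y - b)"
      have "Q x (y - b)" using less.prems b by (intro less.hyps *) (auto simp: ht_diff ht_base)
      then show ?thesis using assms(5) less.prems b by blast
    next
      fix b assume b: "b \<in> B" "x + b \<in> P" "root_le B (x + b) y"
      have "Q (x + b) y" using less.prems b by (intro less.hyps *) (auto simp: ht_diff ht_add ht_base)
      then show ?thesis using assms(6) less.prems b by blast
    qed
  qed (use assms(4) less in auto)
qed

text \<open>When the interval is shortened from above, a cover found in the smaller interval still
  serves; if that interval is a single point, \<open>b\<close> gives the cover.\<close>

lemma root_le_cover:
  assumes "root_le B x y" "x \<in> P" "y \<in> P" "x \<noteq> y"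
  shows "\<exists>b\<in>B. x + b \<in> P \<and> root_le B (x + b) y"
  using assms(4)
proof (induction rule: root_le_induct[OF assms(1-3)])
  case (2 x y b)
  show ?case
  proof (cases "x = y - b")
    case True
    then show ?thesis using 2 root_le_refl by (intro bexI[of _ b]) auto
  next
    case False
    then obtain c where "c \<in> B" "x + c \<in> P" "root_le B (x + c) (y - b)" using 2 by auto
    moreover have "root_le B (y - b) y" using root_le_add[of b "y - b"] B_in_P 2 by auto
    ultimately show ?thesis using root_le_trans by blast
  qed
qed auto

lemma root_le_ideal:
  assumes "root_le B x y" "x \<in> P" "y \<in> P" "x \<in> I"
    and "\<And>z b. \<lbrakk>z \<in> I; z \<in> P; b \<in> B; z + b \<in> P\<rbrakk> \<Longrightarrow> z + b \<in> I"
  shows "y \<in> I"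
  using assms(4)
proof (induction rule: root_le_induct[OF assms(1-3)])
  case (2 x y b)
  then show ?case using assms(5)[of "y - b" b] by auto
next
  case (3 x y b)
  then show ?case using assms(5)[of x b] by auto
qed auto

lemma upper_ideal_root_le:
  assumes "upper_ideal R B I" "root_le B x y" "x \<in> I" "y \<in> P"
  shows "y \<in> I"
proof (rule root_le_ideal[OF assms(2)])
  fix z b assume "z \<in> I" "z \<in> P" "b \<in> B" "z + b \<in> P"
  then show "z + b \<in> I"
    using assms(1) B_in_P unfolding upper_ideal_def by (metis add.commute)
qed (use assms in \<open>auto simp: upper_ideal_def\<close>)

text \<open>A positive term in the expansion of \<open>x \<bullet> x\<close> supplies
  \<open>b\<close>; its coordinate in \<open>x\<close> is at least 1, so subtracting it leaves no
  negative coordinate.\<close>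

lemma P_decomp:
  assumes x: "x \<in> P" "x \<notin> B"
  shows "\<exists>b\<in>B. x \<bullet> b > 0 \<and> x - b \<in> P"
proof -
  have "x \<bullet> x > 0" using root_pos P_in_R x by auto
  then have "(\<Sum>b\<in>B. cf x b * (b \<bullet> x)) > 0" using inner_expand[of x x] by simp
  then obtain b where b: "b \<in> B" and prod: "cf x b * (b \<bullet> x) > 0"
    by (meson not_less sum_nonpos)
  then have xb: "x \<bullet> b > 0" "cf x b > 0"
    using P_cf_nonneg[OF x(1) b] by (auto simp: zero_less_mult_iff inner_commute)
  have "x \<noteq> b" using x b by auto
  then have "x - b \<in> R" using x b xb P_in_R B_in_R by (intro sub_root) auto
  moreover have "cf (x - b) c \<ge> 0" if "c \<in> B" for c
    using P_cf_ge1[OF x(1) b xb(2)] P_cf_nonneg[OF x(1) that] b by (auto simp: cf_diff cf_base)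
  ultimately show ?thesis using b xb by (auto simp: P_iff_cf)
qed

text \<open>The hypothesis covers all lower positive roots, not just \<open>x - b\<close>, so that
  it also applies to the reflected root \<open>root_refl b x\<close>.\<close>

lemma P_induct [consumes 1, case_names base step]:
  assumes "x \<in> P" and "\<And>b. b \<in> B \<Longrightarrow> Q b"
    and "\<And>x b. \<lbrakk>x \<in> P; b \<in> B; x \<bullet> b > 0; x - b \<in> P; \<And>y. y \<in> P \<Longrightarrow> ht y < ht x \<Longrightarrow> Q y\<rbrakk> \<Longrightarrow> Q x"
  shows "Q x"
  using assms(1)
proof (induction "nat \<lfloor>ht x\<rfloor>" arbitrary: x rule: less_induct)
  case less
  show ?case
  proof (cases "x \<in> B")
    case False
    then obtain b where "b \<in> B" "x \<bullet> b > 0" "x - b \<in> P" using P_decomp less by auto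
    moreover have "Q y" if "y \<in> P" "ht y < ht x" for y
    proof (rule less.hyps)
      have "ht y \<in> \<nat>" "ht x \<in> \<nat>" using that less.prems ht_nat by (auto simp: pos_roots_def)
      then show "nat \<lfloor>ht y\<rfloor> < nat \<lfloor>ht x\<rfloor>" using that by (auto elim!: Nats_cases)
    qed fact
    ultimately show ?thesis using assms(3) less.prems by blast
  qed (use assms in auto)
qed

subsection \<open>The highest root\<close>

text \<open>Connectedness of the non-orthogonality graph, expressed by cuts instead of paths; the
  empty set counts as connected.\<close>

definition conn :: "'a set \<Rightarrow> bool" where
  "conn X \<longleftrightarrow> (\<forall>C D. C \<union> D = X \<and> C \<inter> D = {} \<and> C \<noteq> {} \<and> D \<noteq> {} \<longrightarrow> (\<exists>c\<in>C. \<exists>d\<in>D. c \<bullet> d \<noteq> 0))"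

definition supp :: "'a \<Rightarrow> 'a set" where "supp x = {b\<in>B. cf x b > 0}"

lemma supp_sub_B: "supp x \<subseteq> B" by (auto simp: supp_def)

lemma root_refl_cf:
  "b \<in> B \<Longrightarrow> cf (root_refl b x) c = cf x c - (if c = b then (2 * (x \<bullet> b)) / (b \<bullet> b) else 0)"
  by (simp add: root_refl_def cf_diff cf_scale cf_base)

lemma conn_insert:
  assumes "conn X" "c \<in> X" "c \<bullet> a \<noteq> 0" shows "conn (insert a X)"
  unfolding conn_def
proof (intro allI impI)
  fix C D assume CD: "C \<union> D = insert a X \<and> C \<inter> D = {} \<and> C \<noteq> {} \<and> D \<noteq> {}"
  show "\<exists>c\<in>C. \<exists>d\<in>D. c \<bullet> d \<noteq> 0"
  proof (cases "a \<in> X")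
    case True
    then show ?thesis using assms(1) CD by (auto simp: conn_def insert_absorb)
  next
    case a: False
    have "\<exists>c\<in>C'. \<exists>d\<in>D'. c \<bullet> d \<noteq> 0"
      if CD': "C' \<union> D' = insert a X" "C' \<inter> D' = {}" "D' \<noteq> {}" "a \<in> C'" for C' D'
    proof (cases "C' = {a}")
      case True
      then have "c \<in> D'" using CD' assms a by auto
      then show ?thesis using True assms by (auto simp: inner_commute)
    next
      case False
      have "(C' - {a}) \<union> D' = X" "(C' - {a}) \<inter> D' = {}" "C' - {a} \<noteq> {}" using CD' a False by auto
      then have "\<exists>c\<in>C' - {a}. \<exists>d\<in>D'. c \<bullet> d \<noteq> 0" using assms(1) CD'(3) unfolding conn_def by blast
      then show ?thesis by blast
    qed
    from this[of C D] this[of D C] have "a \<in> C \<Longrightarrow> ?thesis" "a \<in> D \<Longrightarrow> \<exists>c\<in>D. \<exists>d\<in>C. c \<bullet> d \<noteq> 0"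
      using CD by (simp_all add: Int_commute Un_commute)
    moreover have "a \<in> C \<or> a \<in> D" using CD by auto
    ultimately show ?thesis by (metis inner_commute)
  qed
qed

text \<open>Simple roots are removed one at a time. If the removed \<open>b\<close> were new and
  orthogonal to the rest of the support, reflecting \<open>x\<close> in \<open>b\<close> would
  subtract twice \<open>b\<close> and leave coordinates of both signs.\<close>

lemma conn_supp: "x \<in> P \<Longrightarrow> conn (supp x)"
proof (induction rule: P_induct)
  case (base b)
  then have "supp b = {b}" by (auto simp: supp_def cf_base)
  moreover have "conn {b}" unfolding conn_def by (auto simp: Un_singleton_iff)
  ultimately show ?case by simp
next
  case (step x b)
  have c: "conn (supp (x - b))"
    using step by (auto simp: ht_diff ht_base)
  have s: "supp x = insert b (supp (x - b))"
    using P_cf_nonneg[OF step(4)] P_cf_nonneg[OF step(4,2)] step(2)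
    by (auto simp: supp_def cf_diff cf_base split: if_splits)
  show ?case
  proof (cases "b \<in> supp (x - b)")
    case True
    then show ?thesis using s c by (simp add: insert_absorb)
  next
    case b: False
    then have b0: "cf (x - b) b = 0" using P_cf_nonneg[OF step(4,2)] step(2) by (auto simp: supp_def)
    have "\<exists>c\<in>supp (x - b). c \<bullet> b \<noteq> 0"
    proof (rule ccontr)
      assume "\<not> ?thesis"
      then have "\<forall>c\<in>B. cf (x - b) c * (c \<bullet> b) = 0"
        using P_cf_nonneg[OF step(4)] by (force simp: supp_def)
      then have "(x - b) \<bullet> b = 0" unfolding inner_expand[of "x - b" b] by (intro sum.neutral)
      then have "2 * (x \<bullet> b) / (b \<bullet> b) = 2" using root_pos[OF B_in_R[OF step(2)]]
        by (simp add: inner_diff_left)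
      then have r: "cf (root_refl b x) c = cf (x - b) c - (if c = b then 1 else 0)" for c
        by (simp add: root_refl_cf step(2) cf_diff cf_base)
      obtain c where c: "c \<in> B" "cf (x - b) c > 0" using P_cf_pos_ex step(4) by auto
      have "root_refl b x \<in> P"
        using c b0 r P_in_R refl_in_R B_in_R step(1,2) by (intro P_if_cf_pos[OF _ c(1)]) auto
      then show False using P_cf_nonneg[of "root_refl b x" b] r[of b] b0 step(2) by auto
    qed
    then show ?thesis using s c conn_insert by auto
  qed
qed

text \<open>A cut of \<open>B\<close> into orthogonal halves would split the roots according to the
  half containing their support, since supports are connected. That contradicts
  irreducibility.\<close>

lemma conn_B: "conn B"
  unfolding conn_def
proof (intro allI impI, rule ccontr)
  fix C D assume CD: "C \<union> D = B \<and> C \<inter> D = {} \<and> C \<noteq> {} \<and> D \<noteq> {}"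
    and "\<not> (\<exists>c\<in>C. \<exists>d\<in>D. c \<bullet> d \<noteq> 0)"
  then have orth: "c \<bullet> d = 0" if "c \<in> C" "d \<in> D" for c d using that by auto
  have one: "supp x \<subseteq> C \<or> supp x \<subseteq> D" if x: "x \<in> P" for x
  proof (rule ccontr)
    assume "\<not> ?thesis"
    then have "(supp x \<inter> C) \<union> (supp x \<inter> D) = supp x \<and> (supp x \<inter> C) \<inter> (supp x \<inter> D) = {} \<and>
      supp x \<inter> C \<noteq> {} \<and> supp x \<inter> D \<noteq> {}" using CD supp_sub_B by blast
    then show False using conn_supp[OF x] orth unfolding conn_def by blast
  qed
  have cf0: "cf x b = 0" if "x \<in> P" "b \<in> B" "b \<notin> supp x" for x b
    using that P_cf_nonneg by (force simp: supp_def)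
  have spanC: "x \<in> span (supp x)" if "x \<in> P" for x
  proof -
    have "cf x b *\<^sub>R b \<in> span (supp x)" if "b \<in> B" for b
      using cf0[OF \<open>x \<in> P\<close> that] by (cases "b \<in> supp x") (auto intro: span_base span_scale simp: span_zero)
    then have "(\<Sum>b\<in>B. cf x b *\<^sub>R b) \<in> span (supp x)" by (rule span_sum)
    then show ?thesis by (simp add: cf_expand)
  qed
  have in_CD: "x \<in> span C \<or> x \<in> span D" if "x \<in> R" for x
  proof -
    have "y \<in> span C \<or> y \<in> span D" if "y \<in> P" for y
      using one[OF that] spanC[OF that] span_mono by blast
    then show ?thesis using R_cases[OF that] span_neg by fastforce
  qed
  have "orthogonal x y" if "x \<in> span C" "y \<in> span D" for x y
  proof (rule orthogonal_to_span[OF that(2)])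
    fix d assume "d \<in> D"
    then have "orthogonal d x" using orth
      by (intro orthogonal_to_span[OF that(1)]) (auto simp: orthogonal_def inner_commute)
    then show "orthogonal x d" by (simp add: orthogonal_commute)
  qed
  then have osp: "x \<bullet> y = 0" if "x \<in> span C" "y \<in> span D" for x y
    using that by (auto simp: orthogonal_def)
  let ?R1 = "R \<inter> span C" and ?R2 = "R \<inter> span D"
  have "?R1 \<union> ?R2 = R" using in_CD by auto
  moreover have "?R1 \<inter> ?R2 = {}" using osp root_pos by fastforce
  moreover have "?R1 \<noteq> {}" "?R2 \<noteq> {}" using CD B_in_R span_base by blast+
  moreover have "\<forall>x\<in>?R1. \<forall>y\<in>?R2. x \<bullet> y = 0" using osp by auto
  ultimately have "\<exists>R1 R2. R1 \<noteq> {} \<and> R2 \<noteq> {} \<and> R1 \<union> R2 = R \<and> R1 \<inter> R2 = {} \<and> (\<forall>x\<in>R1. \<forall>y\<in>R2. x \<bullet> y = 0)"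
    by (intro exI[of _ ?R1] exI[of _ ?R2] conjI)
  with irreducible show False unfolding irreducible_rs_def by (elim conjE notE)
qed

lemma R_nonempty: "R \<noteq> {}" using irreducible by (simp add: irreducible_rs_def)

lemma P_nonempty: "P \<noteq> {}" using R_nonempty R_cases by blast

text \<open>As \<open>d\<close> does not occur in \<open>x\<close>, the expansion has only
  nonpositive terms, and the neighbour \<open>c\<close> contributes a strictly negative one.\<close>

lemma inner_neg_supp:
  assumes x: "x \<in> P" and c: "c \<in> supp x" and d: "d \<in> B" "d \<notin> supp x" and cd: "c \<bullet> d \<noteq> 0"
  shows "x \<bullet> d < 0"
proof -
  have "cf x d = 0" using d P_cf_nonneg[OF x] by (force simp: supp_def)
  have "x \<bullet> d = (\<Sum>b\<in>B. cf x b * (b \<bullet> d))" by (rule inner_expand)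
  also have "\<dots> < (\<Sum>b\<in>B. 0)"
  proof (rule sum_strict_mono_ex1[OF finite_B])
    show "\<forall>b\<in>B. cf x b * (b \<bullet> d) \<le> 0"
    proof
      fix b assume b: "b \<in> B"
      show "cf x b * (b \<bullet> d) \<le> 0"
        using \<open>cf x d = 0\<close> P_cf_nonneg[OF x b] base_inner_nonpos[of b d] b d
        by (cases "b = d") (auto simp: mult_nonneg_nonpos)
    qed
    have "c \<bullet> d < 0" using base_inner_nonpos[of c d] c d cd by (force simp: supp_def)
    then show "\<exists>b\<in>B. cf x b * (b \<bullet> d) < 0"
      using c by (intro bexI[of _ c]) (auto simp: supp_def mult_pos_neg)
  qed
  finally show ?thesis by simp
qed

text \<open>A negative product with \<open>b\<close> would make \<open>x + b\<close> a root. If some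
  simple root were missing from the support, connectedness would give one outside it pairing
  negatively with \<open>x\<close>, against dominance.\<close>

lemma uncovered_dominant:
  assumes x: "x \<in> P" and unc: "\<And>b. b \<in> B \<Longrightarrow> x + b \<notin> P"
  shows "\<And>b. b \<in> B \<Longrightarrow> x \<bullet> b \<ge> 0" and "\<And>b. b \<in> B \<Longrightarrow> cf x b > 0"
proof -
  show dom: "x \<bullet> b \<ge> 0" if b: "b \<in> B" for b
  proof (rule ccontr)
    assume "\<not> ?thesis"
    moreover have "x \<noteq> - b" using x b B_in_P P_not_neg by auto
    ultimately have "x + b \<in> R" using x b P_in_R B_in_R by (intro add_root) auto
    then have "x + b \<in> P" using root_ge_P[OF x] root_le_add B_in_P b by auto
    then show False using unc b by auto
  qed
  show "cf x b > 0" if b: "b \<in> B" for b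
  proof (rule ccontr)
    assume "\<not> ?thesis"
    then have "supp x \<union> (B - supp x) = B \<and> supp x \<inter> (B - supp x) = {} \<and> supp x \<noteq> {} \<and> B - supp x \<noteq> {}"
      using b P_cf_pos_ex[OF x] by (auto simp: supp_def)
    then obtain c d where c: "c \<in> supp x" and d: "d \<in> B - supp x" and cd: "c \<bullet> d \<noteq> 0"
      using conn_B unfolding conn_def by meson
    then show False using inner_neg_supp[OF x c _ _ cd] dom[of d] by auto
  qed
qed

lemma inner_pos_dominant:
  assumes "x \<noteq> 0" "\<And>b. b \<in> B \<Longrightarrow> x \<bullet> b \<ge> 0" "\<And>b. b \<in> B \<Longrightarrow> cf y b > 0"
  shows "x \<bullet> y > 0"
proof -
  have "\<exists>b\<in>B. x \<bullet> b > 0"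
  proof (rule ccontr)
    assume "\<not> ?thesis"
    then have "\<forall>b\<in>B. b \<bullet> x = 0" using assms(2) by (force simp: inner_commute)
    then have "x \<bullet> x = 0" by (subst inner_expand) simp
    then show False using assms by simp
  qed
  then obtain c where "c \<in> B" "x \<bullet> c > 0" by auto
  then have "(\<Sum>b\<in>B. cf y b * (b \<bullet> x)) > 0"
    using assms(2,3) by (intro sum_pos2[OF finite_B, of c]) (auto simp: inner_commute less_imp_le)
  then show ?thesis using inner_expand[of y x] by (simp add: inner_commute)
qed

text \<open>The candidate \<open>t\<close> has maximal height. Any \<open>x\<close> lies below some
  \<open>y\<close> that no simple root can enlarge. Both \<open>t\<close> and \<open>y\<close> are
  dominant with full support, hence pair positively, so they are equal or differ by a root whose
  sign is decided by height.\<close>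

lemma highest_root_ex: "\<exists>t\<in>P. \<forall>x\<in>P. root_le B x t"
proof -
  obtain t where t: "t \<in> P" and max: "\<And>x. x \<in> P \<Longrightarrow> ht x \<le> ht t"
    using finite_real_max_ex[OF finite_P P_nonempty, of ht] by auto
  have unc: "t + b \<notin> P" if "b \<in> B" for b using max[of "t + b"] that by (auto simp: ht_add ht_base)
  have "root_le B x t" if x: "x \<in> P" for x
  proof -
    let ?Y = "{y\<in>P. root_le B x y}"
    have "finite ?Y" "?Y \<noteq> {}" using finite_P x root_le_refl by auto
    from finite_real_max_ex[OF this, of ht]
    obtain y where y: "y \<in> P" "root_le B x y" and ymax: "\<And>z. z \<in> ?Y \<Longrightarrow> ht z \<le> ht y"
      by auto
    have yunc: "y + b \<notin> P" if "b \<in> B" for b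
      using ymax[of "y + b"] root_le_trans[OF y(2) root_le_add[OF B_in_P[OF that]]] that
      by (auto simp: ht_add ht_base)
    have "t \<noteq> 0" using t P_in_R zero_notin_R by auto
    then have "t \<bullet> y > 0"
      using uncovered_dominant(1)[OF t unc] uncovered_dominant(2)[OF y(1) yunc] by (rule inner_pos_dominant)
    show ?thesis
    proof (cases "y = t")
      case False
      then have r: "y - t \<in> R" using \<open>t \<bullet> y > 0\<close> t y P_in_R by (intro sub_root) (auto simp: inner_commute)
      show ?thesis
        using R_cases[OF r]
      proof
        assume "y - t \<in> P"
        then have "ht y > ht t" using ht_P_ge1 by (force simp: ht_diff)
        then show ?thesis using max[OF y(1)] by simp
      next
        assume n: "- (y - t) \<in> P"
        then have "root_le B y t" using root_le_add[OF n, of y] by simp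
        then show ?thesis using root_le_trans y by blast
      qed
    qed (use y in simp)
  qed
  then show ?thesis using t by auto
qed

abbreviation \<theta> where "\<theta> \<equiv> highest_root R B"

lemma theta: "\<theta> \<in> P" "x \<in> P \<Longrightarrow> root_le B x \<theta>"
proof -
  obtain t where t: "t \<in> P" "\<forall>x\<in>P. root_le B x t" using highest_root_ex by (elim bexE)
  then have "\<theta> = t"
    unfolding highest_root_def by (intro the_equality conjI) (blast intro: root_le_antisym)+
  then show "\<theta> \<in> P" "x \<in> P \<Longrightarrow> root_le B x \<theta>" using t by blast+
qed

lemma theta_uncovered: "b \<in> B \<Longrightarrow> \<theta> + b \<notin> P"
  using theta(2)[of "\<theta> + b"] ht_mono by (force simp: ht_add ht_base)

lemma theta_dominant: "b \<in> B \<Longrightarrow> \<theta> \<bullet> b \<ge> 0"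
  and theta_cf_pos: "b \<in> B \<Longrightarrow> cf \<theta> b > 0"
  using uncovered_dominant[OF theta(1) theta_uncovered] by auto

lemma theta_in_R: "\<theta> \<in> R" using theta P_in_R by auto

lemma theta_inner_P: "x \<in> P \<Longrightarrow> x \<bullet> \<theta> \<ge> 0"
  unfolding inner_expand[of x \<theta>] using theta_dominant
  by (auto intro!: sum_nonneg mult_nonneg_nonneg simp: P_cf_nonneg inner_commute)

lemma P_if_theta_inner_pos: "\<lbrakk>x \<in> R; x \<bullet> \<theta> > 0\<rbrakk> \<Longrightarrow> x \<in> P"
  using R_cases[of x] theta_inner_P[of "- x"] by auto

lemma root_cover: "\<lbrakk>x \<in> P; x \<noteq> \<theta>\<rbrakk> \<Longrightarrow> \<exists>b\<in>B. x + b \<in> P"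
  using root_le_cover[of x \<theta>] theta by blast

text \<open>Covering negative roots too allows its use on Weyl group images of unknown sign.\<close>

lemma root_cf_le_theta: "\<lbrakk>x \<in> R; b \<in> B\<rbrakk> \<Longrightarrow> cf x b \<le> cf \<theta> b"
  using R_cases[of x]
proof
  assume "x \<in> R" "b \<in> B" "x \<in> P"
  then show ?thesis using theta(2)[of x] root_le_iff_cf theta_in_R by blast
next
  assume "x \<in> R" "b \<in> B" "- x \<in> P"
  then show ?thesis using P_cf_nonneg[of "- x" b] theta_cf_pos[of b] by (simp add: cf_neg)
qed

text \<open>Among the longest roots take \<open>l\<close> of maximal height. It is dominant, since a
  reflection cannot raise its height, and \<open>\<theta> - l\<close> has nonnegative coordinates;
  pairing that with \<open>l\<close> and with \<open>\<theta>\<close> gives (l,l) <= (l,\<theta>) <=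
  (\<theta>,\<theta>).\<close>

lemma theta_long: "x \<in> R \<Longrightarrow> x \<bullet> x \<le> \<theta> \<bullet> \<theta>"
proof -
  assume x: "x \<in> R"
  obtain m where m: "m \<in> R" "\<And>y. y \<in> R \<Longrightarrow> y \<bullet> y \<le> m \<bullet> m"
    using finite_real_max_ex[OF finite_R R_nonempty, of "\<lambda>y. y \<bullet> y"] by auto
  let ?L = "{y\<in>R. y \<bullet> y = m \<bullet> m}"
  have "finite ?L" "?L \<noteq> {}" using finite_R m by auto
  from finite_real_max_ex[OF this, of ht]
  obtain l where l: "l \<in> R" "l \<bullet> l = m \<bullet> m" and lmax: "\<And>z. z \<in> ?L \<Longrightarrow> ht z \<le> ht l"
    by auto
  have dom: "b \<bullet> l \<ge> 0" if b: "b \<in> B" for b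
  proof -
    have "root_refl b l \<in> ?L" using l b B_in_R refl_in_R by (auto simp: root_refl_inner)
    then have "ht (root_refl b l) \<le> ht l" by (rule lmax)
    then have "2 * (l \<bullet> b) / (b \<bullet> b) \<ge> 0" using b by (simp add: root_refl_def ht_diff ht_scale ht_base)
    then show ?thesis using root_pos[OF B_in_R[OF b]] by (simp add: zero_le_divide_iff inner_commute)
  qed
  have inner_l: "y \<bullet> l \<ge> 0" if "\<And>b. b \<in> B \<Longrightarrow> cf y b \<ge> 0" for y
    unfolding inner_expand[of y l] by (auto intro!: sum_nonneg mult_nonneg_nonneg simp: that dom)
  have "- l \<notin> P" using inner_l[of "- l"] P_cf_nonneg[of "- l"] root_pos[OF l(1)] by auto
  then have lP: "l \<in> P" using R_cases l by auto
  have "(\<theta> - l) \<bullet> l \<ge> 0"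
    using root_cf_le_theta[OF l(1)] by (intro inner_l) (simp add: cf_diff)
  moreover have "(\<theta> - l) \<bullet> \<theta> \<ge> 0"
    unfolding inner_expand[of "\<theta> - l" \<theta>] using root_cf_le_theta[OF l(1)] theta_dominant
    by (auto intro!: sum_nonneg mult_nonneg_nonneg simp: cf_diff inner_commute)
  ultimately have "l \<bullet> l \<le> \<theta> \<bullet> \<theta>"
    by (simp add: inner_diff_left inner_commute[of l \<theta>])
  then show ?thesis using m(2)[OF x] l by simp
qed

subsection \<open>The Weyl group\<close>

text \<open>As the system is reduced, \<open>x\<close> has a positive coordinate at a simple root
  other than \<open>a\<close>, and the reflection leaves it unchanged.\<close>

lemma simple_refl_P:
  assumes "a \<in> B" "x \<in> P" "x \<noteq> a" shows "root_refl a x \<in> P"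
proof -
  have "\<exists>b\<in>B. b \<noteq> a \<and> cf x b > 0"
  proof (rule ccontr)
    assume "\<not> ?thesis"
    then have 0: "cf x b = 0" if "b \<in> B" "b \<noteq> a" for b
      using P_cf_nonneg[OF assms(2)] that by force
    then have x: "x = cf x a *\<^sub>R a"
      by (intro cf_eq) (auto simp: cf_scale cf_base assms)
    then have "cf x a = 1 \<or> cf x a = -1"
      using reduced assms(1,2) B_in_R P_in_R unfolding reduced_rs_def by metis
    moreover have "cf x a \<noteq> -1" using P_cf_nonneg[OF assms(2,1)] by auto
    ultimately show False using x assms(3) by (metis scaleR_one)
  qed
  then obtain b where b: "b \<in> B" "b \<noteq> a" "cf x b > 0" by auto
  then show ?thesis
    using assms P_in_R B_in_R refl_in_R by (intro P_if_cf_pos[of _ b]) (auto simp: root_refl_cf)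
qed

lemma refl_word_in_R: "\<lbrakk>set xs \<subseteq> R; x \<in> R\<rbrakk> \<Longrightarrow> refl_word xs x \<in> R"
  by (induction xs) (auto intro: refl_in_R)

text \<open>At a letter that turns the image of \<open>c\<close> negative, the image just before is
  that letter itself by \<open>simple_refl_P\<close>; conjugation then cancels the letter against
  \<open>root_refl c\<close>. Only the drop in length is recorded, as minimality arguments ask for
  no more.\<close>

lemma strong_exchange:
  assumes "set xs \<subseteq> B" "c \<in> P" "refl_word xs c \<notin> P"
  shows "\<exists>ys. set ys \<subseteq> B \<and> length ys < length xs \<and> refl_word xs \<circ> root_refl c = refl_word ys"
  using assms
proof (induction xs)
  case (Cons a xs)
  show ?case
  proof (cases "refl_word xs c \<in> P")
    case True
    then have "refl_word xs c = a" using simple_refl_P[of a] Cons by auto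
    then have "root_refl a (refl_word xs (root_refl c x)) = refl_word xs x" for x
      using root_refl_conj[OF refl_word_linear[of xs] refl_word_inner[of xs], of c "root_refl c x"]
      by (simp add: root_refl_involution)
    then have "refl_word (a # xs) \<circ> root_refl c = refl_word xs" by (simp add: fun_eq_iff)
    then show ?thesis using Cons.prems(1) by (intro exI[of _ xs]) (auto simp del: refl_word_Cons)
  next
    case False
    then obtain ys where "set ys \<subseteq> B" "length ys < length xs" "refl_word xs \<circ> root_refl c = refl_word ys"
      using Cons.IH[OF _ Cons.prems(2) False] Cons.prems(1) unfolding set_simps insert_subset by blast
    then show ?thesis using Cons.prems(1)
      by (intro exI[of _ "a # ys"] conjI) (simp_all only: refl_word_Cons comp_assoc, simp_all)
  qed
qed auto

text \<open>Reflecting in a simple root \<open>b\<close> with \<open>x \<bullet> b > 0\<close>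
  lowers the height and stays positive unless \<open>x = b\<close>.\<close>

lemma P_simple_conj:
  assumes "x \<in> P" shows "\<exists>xs a. set xs \<subseteq> B \<and> a \<in> B \<and> refl_word xs a = x"
  using assms
proof (induction rule: P_induct)
  case (base b)
  then show ?case by (intro exI[of _ "[]"] exI[of _ b]) auto
next
  case (step x b)
  show ?case
  proof (cases "x = b")
    case True
    then show ?thesis using step by (intro exI[of _ "[]"] exI[of _ b]) auto
  next
    case False
    have "ht (root_refl b x) < ht x"
      using step root_pos[OF B_in_R[OF step(2)]] by (simp add: root_refl_def ht_diff ht_scale ht_base)
    moreover have "root_refl b x \<in> P" using simple_refl_P step False by auto
    ultimately obtain xs a where "set xs \<subseteq> B" "a \<in> B" "refl_word xs a = root_refl b x" using step by metis
    then show ?thesis using step by (intro exI[of _ "b # xs"] exI[of _ a]) (auto simp: root_refl_involution)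
  qed
qed

lemma root_refl_word:
  assumes "x \<in> R" shows "\<exists>xs. set xs \<subseteq> B \<and> root_refl x = refl_word xs"
proof -
  have *: "\<exists>xs. set xs \<subseteq> B \<and> root_refl x = refl_word xs" if x: "x \<in> P" for x
  proof -
    obtain xs a where xs: "set xs \<subseteq> B" "a \<in> B" "refl_word xs a = x" using P_simple_conj x by blast
    have "refl_word (xs @ [a] @ rev xs) y = root_refl x y" for y
      using root_refl_conj[OF refl_word_linear[of xs] refl_word_inner[of xs], of a "refl_word (rev xs) y"]
      by (simp add: refl_word_append xs refl_word_rev')
    then have "root_refl x = refl_word (xs @ [a] @ rev xs)" by (simp add: fun_eq_iff)
    then show ?thesis using xs by (intro exI[of _ "xs @ [a] @ rev xs"]) auto
  qed
  show ?thesis using R_cases[OF assms] *[of x] *[of "- x"] by (auto simp: root_refl_uminus)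
qed

text \<open>\<open>weyl_group\<close> is generated by all root reflections, whereas
  \<open>weyl_length\<close> counts simple ones; this joins the two.\<close>

lemma weyl_group_iff: "w \<in> weyl_group R \<longleftrightarrow> (\<exists>xs. set xs \<subseteq> B \<and> w = refl_word xs)"
proof
  assume "w \<in> weyl_group R"
  then show "\<exists>xs. set xs \<subseteq> B \<and> w = refl_word xs"
  proof induction
    case weyl_id
    show ?case by (intro exI[of _ "[]"]) auto
  next
    case (weyl_step w a)
    then obtain xs ys where "set xs \<subseteq> B" "w = refl_word xs" "set ys \<subseteq> B" "root_refl a = refl_word ys"
      using root_refl_word by metis
    then show ?case by (intro exI[of _ "ys @ xs"]) (auto simp: refl_word_append)
  qed
next
  assume "\<exists>xs. set xs \<subseteq> B \<and> w = refl_word xs"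
  then obtain xs where "set xs \<subseteq> B" "w = refl_word xs" by auto
  then show "w \<in> weyl_group R"
    by (induction xs arbitrary: w) (use weyl_id in \<open>auto simp: id_def[symmetric] intro!: weyl_step B_in_R\<close>)
qed

lemma weyl_length_eq: "weyl_length B w = (LEAST n. \<exists>xs. set xs \<subseteq> B \<and> length xs = n \<and> w = refl_word xs)"
  by (simp add: weyl_length_def refl_word_def)

lemma weyl_length_le: "set xs \<subseteq> B \<Longrightarrow> weyl_length B (refl_word xs) \<le> length xs"
  unfolding weyl_length_eq by (rule Least_le) auto

lemma reduced_word_ex:
  assumes "w \<in> weyl_group R" shows "\<exists>xs. set xs \<subseteq> B \<and> w = refl_word xs \<and> length xs = weyl_length B w"
proof -
  obtain xs where "set xs \<subseteq> B" "w = refl_word xs" using assms weyl_group_iff by blast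
  then have "\<exists>n. \<exists>xs. set xs \<subseteq> B \<and> length xs = n \<and> w = refl_word xs" by auto
  from LeastI_ex[OF this] show ?thesis unfolding weyl_length_eq[symmetric] by blast
qed

text \<open>If a shortest word ended in \<open>a\<close>, its remaining part would send
  \<open>a\<close> to a negative root because \<open>w a\<close> is positive; the exchange argument
  then yields a shorter word for \<open>w\<close>.\<close>

lemma weyl_preserving_P_id:
  assumes w: "w \<in> weyl_group R" and P: "\<And>x. x \<in> P \<Longrightarrow> w x \<in> P"
  shows "w = id"
proof -
  obtain xs where xs: "set xs \<subseteq> B" "w = refl_word xs" "length xs = weyl_length B w"
    using reduced_word_ex w by blast
  show ?thesis
  proof (cases xs rule: rev_cases)
    case (snoc ys a)
    have a: "a \<in> B" and ys: "set ys \<subseteq> B" using xs snoc by auto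
    have weq: "w = refl_word ys \<circ> root_refl a" using xs snoc by (simp add: refl_word_append)
    have "w a = - refl_word ys a"
      by (simp add: weq root_refl_self linear_neg[OF refl_word_linear])
    then have "refl_word ys a \<notin> P" using P[OF B_in_P[OF a]] P_not_neg by auto
    from strong_exchange[OF ys B_in_P[OF a] this] obtain zs where
      "set zs \<subseteq> B" "length zs < length ys" "w = refl_word zs" using weq by auto
    then show ?thesis using weyl_length_le[of zs] xs snoc by auto
  qed (use xs in simp)
qed

lemma weyl_linear: "w \<in> weyl_group R \<Longrightarrow> linear w"
  and weyl_inner: "w \<in> weyl_group R \<Longrightarrow> w x \<bullet> w y = x \<bullet> y"
  and weyl_in_R: "\<lbrakk>w \<in> weyl_group R; x \<in> R\<rbrakk> \<Longrightarrow> w x \<in> R"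
  using B_sub_R by (auto simp: weyl_group_iff refl_word_linear refl_word_inner intro!: refl_word_in_R)

lemma weyl_inverse_ex:
  assumes "w \<in> weyl_group R"
  shows "\<exists>v\<in>weyl_group R. (\<forall>x. v (w x) = x) \<and> (\<forall>x. w (v x) = x)"
proof -
  obtain xs where "set xs \<subseteq> B" "w = refl_word xs" using assms weyl_group_iff by blast
  then show ?thesis
    by (intro bexI[of _ "refl_word (rev xs)"]) (auto simp: weyl_group_iff refl_word_rev refl_word_rev' intro!: exI[of _ "rev xs"])
qed

lemma weyl_comp: "\<lbrakk>v \<in> weyl_group R; w \<in> weyl_group R\<rbrakk> \<Longrightarrow> v \<circ> w \<in> weyl_group R"
  unfolding weyl_group_iff by (metis refl_word_append set_append Un_least)

lemma weyl_refl: "a \<in> R \<Longrightarrow> root_refl a \<in> weyl_group R"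
  using weyl_step[OF weyl_id] by (simp add: comp_id)

text \<open>Otherwise the whole orbit is orthogonal to \<open>t\<close>, being closed under
  negation. The roots in its span and the roots orthogonal to it then split \<open>R\<close>,
  against irreducibility.\<close>

lemma inner_orbit_nonzero:
  assumes a: "a \<in> R" and t: "t \<in> R" shows "\<exists>w\<in>weyl_group R. w a \<bullet> t > 0"
proof (rule ccontr)
  assume neg: "\<not> ?thesis"
  define Orb where "Orb = (\<lambda>w. w a) ` weyl_group R"
  have aO: "a \<in> Orb" unfolding Orb_def using weyl_id by (metis id_apply image_eqI)
  have closed: "root_refl b x \<in> Orb" if "b \<in> R" "x \<in> Orb" for b x
    using that weyl_step by (auto simp: Orb_def intro!: image_eqI[where x="root_refl b \<circ> _"])
  have O_R: "Orb \<subseteq> R" using weyl_in_R a by (auto simp: Orb_def)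
  have Ot: "x \<bullet> t = 0" if "x \<in> Orb" for x
  proof -
    have "- x \<in> Orb" using closed[of x x] that O_R by (auto simp: root_refl_self)
    moreover have "\<not> y \<bullet> t > 0" if "y \<in> Orb" for y using neg that by (auto simp: Orb_def)
    ultimately have "\<not> x \<bullet> t > 0" "\<not> (- x) \<bullet> t > 0" using that by blast+
    then show ?thesis by simp
  qed
  let ?R1 = "R \<inter> span Orb" and ?R2 = "{x\<in>R. \<forall>y\<in>Orb. y \<bullet> x = 0}"
  have orth: "\<forall>x\<in>?R1. \<forall>y\<in>?R2. x \<bullet> y = 0"
  proof (intro ballI)
    fix x y assume x: "x \<in> ?R1" and y: "y \<in> ?R2"
    have "orthogonal y x"
    proof (rule orthogonal_to_span)
      show "x \<in> span Orb" using x by blast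
      show "orthogonal y z" if "z \<in> Orb" for z
        using y that unfolding orthogonal_def inner_commute[of y z] by blast
    qed
    then show "x \<bullet> y = 0" unfolding orthogonal_def inner_commute[of y x] .
  qed
  have "x \<in> ?R1 \<or> x \<in> ?R2" if x: "x \<in> R" for x
  proof (cases "\<forall>y\<in>Orb. y \<bullet> x = 0")
    case False
    then obtain y where y: "y \<in> Orb" "y \<bullet> x \<noteq> 0" by auto
    \<comment> \<open>If \<open>x\<close> pairs nontrivially with an orbit element \<open>y\<close>,
      it is a multiple of the difference of the orbit elements \<open>y\<close> and
      \<open>root_refl x y\<close>.\<close>
    define k where "k = (2 * (y \<bullet> x)) / (x \<bullet> x)"
    have k: "k \<noteq> 0" using y root_pos[OF x] by (simp add: k_def)
    have "k *\<^sub>R x = y - root_refl x y" by (simp add: root_refl_def k_def)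
    also have "\<dots> \<in> span Orb" using closed[OF x y(1)] y(1) by (intro span_diff span_base)
    finally have "(1 / k) *\<^sub>R (k *\<^sub>R x) \<in> span Orb" by (rule span_scale)
    then show ?thesis using k x by simp
  qed (use x in auto)
  then have "?R1 \<union> ?R2 = R" by auto
  moreover have "?R1 \<inter> ?R2 = {}" using orth root_pos by fastforce
  moreover have "?R1 \<noteq> {}" using aO a span_base by blast
  moreover have "?R2 \<noteq> {}" using Ot t by blast
  ultimately have "\<exists>R1 R2. R1 \<noteq> {} \<and> R2 \<noteq> {} \<and> R1 \<union> R2 = R \<and> R1 \<inter> R2 = {} \<and> (\<forall>x\<in>R1. \<forall>y\<in>R2. x \<bullet> y = 0)"
    using orth by (intro exI[of _ ?R1] exI[of _ ?R2] conjI)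
  with irreducible show False unfolding irreducible_rs_def by (elim conjE notE)
qed

text \<open>Move \<open>a\<close> by the Weyl group to a root pairing positively with
  \<open>\<theta>\<close>. Both have the same length, so they coincide or the reflection in their
  difference exchanges them.\<close>

lemma long_root_conj:
  assumes a: "a \<in> long_roots R" shows "\<exists>w\<in>weyl_group R. w \<theta> = a"
proof -
  have aR: "a \<in> R" using a by (simp add: long_roots_def)
  have len: "a \<bullet> a = \<theta> \<bullet> \<theta>"
    using a theta_long[OF aR] theta_in_R by (force simp: long_roots_def)
  obtain w where w: "w \<in> weyl_group R" "w a \<bullet> \<theta> > 0" using inner_orbit_nonzero[OF aR theta_in_R] by blast
  obtain v where v: "v \<in> weyl_group R" "\<And>x. v (w x) = x" using weyl_inverse_ex[OF w(1)] by blast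
  show ?thesis
  proof (cases "w a = \<theta>")
    case True
    then show ?thesis using v by metis
  next
    case False
    have wlen: "w a \<bullet> w a = \<theta> \<bullet> \<theta>" using len weyl_inner w by simp
    define d where "d = \<theta> - w a"
    have d: "d \<in> R" unfolding d_def
      using False w weyl_in_R aR theta_in_R by (intro sub_root) (auto simp: inner_commute)
    have "2 * (\<theta> \<bullet> d) = d \<bullet> d"
      using wlen by (simp add: d_def inner_diff_left inner_diff_right inner_commute)
    then have "root_refl d \<theta> = w a" using root_pos[OF d] by (simp add: root_refl_def) (simp add: d_def)
    then have "(v \<circ> root_refl d) \<theta> = a" using v by simp
    then show ?thesis using weyl_comp weyl_refl v d by blast
  qed
qed

text \<open>If a minimal element made some positive \<open>c\<close> orthogonal to
  \<open>\<theta>\<close> negative, composing it with the reflection in \<open>c\<close> would give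
  a shorter one still sending \<open>\<theta>\<close> to \<open>a\<close>. The same property yields
  the uniqueness that the definite description in \<open>w_of\<close> requires.\<close>

lemma w_of_props:
  assumes a: "a \<in> long_roots R"
  shows "w_of R B a \<in> weyl_group R" "w_of R B a \<theta> = a"
    "\<And>c. \<lbrakk>c \<in> P; c \<bullet> \<theta> = 0\<rbrakk> \<Longrightarrow> w_of R B a c \<in> P"
proof -
  define M where "M w \<longleftrightarrow> w \<in> weyl_group R \<and> w \<theta> = a \<and>
      (\<forall>w'\<in>weyl_group R. w' \<theta> = a \<longrightarrow> weyl_length B w \<le> weyl_length B w')" for w
  obtain w0 where w0: "w0 \<in> weyl_group R \<and> w0 \<theta> = a" using long_root_conj[OF a] by auto
  obtain w where w: "M w"
    using ex_has_least_nat[of "\<lambda>w. w \<in> weyl_group R \<and> w \<theta> = a", OF w0, of "weyl_length B"]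
    unfolding M_def by blast
  have pos: "u c \<in> P" if u: "M u" and c: "c \<in> P" "c \<bullet> \<theta> = 0" for u c
  proof (rule ccontr)
    assume neg: "u c \<notin> P"
    obtain xs where xs: "set xs \<subseteq> B" "u = refl_word xs" "length xs = weyl_length B u"
      using reduced_word_ex u by (auto simp: M_def)
    obtain ys where ys: "set ys \<subseteq> B" "length ys < length xs" "u \<circ> root_refl c = refl_word ys"
      using strong_exchange[OF xs(1) c(1)] neg xs(2) by auto
    have "refl_word ys \<theta> = (u \<circ> root_refl c) \<theta>" by (simp only: ys)
    also have "\<dots> = a" using u c by (simp add: root_refl_orth inner_commute M_def)
    finally have "weyl_length B u \<le> weyl_length B (refl_word ys)"
      using u ys(1) weyl_group_iff unfolding M_def by blast
    then show False using weyl_length_le[OF ys(1)] ys(2) xs(3) by simp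
  qed
  have "u = w" if u: "M u" for u
  proof -
    have uW: "u \<in> weyl_group R" and wW: "w \<in> weyl_group R" and ua: "u \<theta> = a" and wa: "w \<theta> = a"
      using u w by (auto simp: M_def)
    obtain v where v: "v \<in> weyl_group R" "\<And>x. v (w x) = x" "\<And>x. w (v x) = x"
      using weyl_inverse_ex[OF wW] by blast
    have va: "v a = \<theta>" using v wa by metis
    \<comment> \<open>The quotient of two minimal elements fixes \<open>\<theta>\<close> and keeps
      positive roots positive: those pairing positively with \<open>\<theta>\<close> because the
      pairing is preserved, the orthogonal ones by \<open>pos\<close> applied to both
      elements.\<close>
    have "v \<circ> u = id"
    proof (rule weyl_preserving_P_id)
      show "v \<circ> u \<in> weyl_group R" using weyl_comp v uW by auto
      fix x assume x: "x \<in> P"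
      have r: "u x \<in> R" "v (u x) \<in> R" using weyl_in_R uW v x P_in_R by auto
      have in_t: "v (u x) \<bullet> \<theta> = x \<bullet> \<theta>" using weyl_inner[OF v(1), of "u x" a] weyl_inner[OF uW, of x \<theta>] va ua by simp
      show "(v \<circ> u) x \<in> P"
      proof (cases "x \<bullet> \<theta> = 0")
        case False
        then have "v (u x) \<bullet> \<theta> > 0" using in_t theta_inner_P[OF x] by auto
        then show ?thesis using P_if_theta_inner_pos r by auto
      next
        case True
        have ux: "u x \<in> P" using pos u x True by auto
        show ?thesis
        proof (rule ccontr)
          assume "\<not> ?thesis"
          then have n: "- v (u x) \<in> P" using R_cases[OF r(2)] by auto
          then have "w (- v (u x)) \<in> P" using pos[OF w n] in_t True by auto
          then have "- u x \<in> P" using v by (simp add: linear_neg[OF weyl_linear[OF wW]])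
          then show False using ux P_not_neg by auto
        qed
      qed
    qed
    then have "w (v (u x)) = w x" for x by (metis comp_apply id_apply)
    then show "u = w" using v by auto
  qed
  then have "w_of R B a = w" unfolding w_of_def M_def[symmetric] using w by (intro the_equality)
  then show "w_of R B a \<in> weyl_group R" "w_of R B a \<theta> = a"
    "\<And>c. \<lbrakk>c \<in> P; c \<bullet> \<theta> = 0\<rbrakk> \<Longrightarrow> w_of R B a c \<in> P"
    using w pos by (auto simp: M_def)
qed

subsection \<open>The maximal abelian ideals\<close>

lemma H_iff: "x \<in> H_set R B \<longleftrightarrow> x \<in> P \<and> x \<bullet> \<theta> > 0"
  by (simp add: H_set_def)

lemma theta_inner_ge: assumes "x \<in> R" "x \<bullet> \<theta> > 0" shows "2 * (x \<bullet> \<theta>) \<ge> \<theta> \<bullet> \<theta>"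
proof -
  obtain k where k: "(2 * (x \<bullet> \<theta>)) / (\<theta> \<bullet> \<theta>) = of_int k"
    using cartan_int[OF theta_in_R assms(1)] by (metis Ints_cases)
  have t: "\<theta> \<bullet> \<theta> > 0" using root_pos theta_in_R by auto
  then have "real_of_int k > 0" unfolding k[symmetric] using assms by simp
  then have "real_of_int k \<ge> 1" by simp
  then show ?thesis unfolding k[symmetric] using t by (simp add: field_simps)
qed

text \<open>As \<open>\<theta>\<close> is longest, the Cartan integer of \<open>x\<close> against it
  is below 2; so \<open>\<theta>\<close> is alone in degree 2 of the grading by this
  integer.\<close>

lemma theta_inner_eq:
  assumes "x \<in> R" "x \<bullet> \<theta> > 0" "x \<noteq> \<theta>" shows "2 * (x \<bullet> \<theta>) = \<theta> \<bullet> \<theta>"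
proof -
  obtain k where k: "(2 * (x \<bullet> \<theta>)) / (\<theta> \<bullet> \<theta>) = of_int k"
    using cartan_int[OF theta_in_R assms(1)] by (metis Ints_cases)
  have t: "\<theta> \<bullet> \<theta> > 0" using root_pos theta_in_R by auto
  have "(\<theta> - x) \<bullet> (\<theta> - x) > 0" using assms by simp
  then have "2 * (x \<bullet> \<theta>) < 2 * (\<theta> \<bullet> \<theta>)"
    using theta_long[OF assms(1)] by (simp add: inner_diff_left inner_diff_right inner_commute[of \<theta> x])
  then have "real_of_int k < 2" unfolding k[symmetric] using t by (simp add: field_simps)
  moreover have "real_of_int k > 0" unfolding k[symmetric] using t assms by simp
  ultimately have "k = 1" by simp
  then show ?thesis using k t by (simp add: field_simps)
qed

lemma theta_diff_root:
  assumes "x \<in> R" "x \<bullet> \<theta> > 0" "x \<noteq> \<theta>" shows "\<theta> - x \<in> P" "(\<theta> - x) \<bullet> \<theta> > 0"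
proof -
  have "\<theta> \<bullet> \<theta> > 0" using root_pos theta_in_R by auto
  then have "2 * (x \<bullet> \<theta>) < 2 * (\<theta> \<bullet> \<theta>)" using theta_inner_eq[OF assms] by linarith
  then show p: "(\<theta> - x) \<bullet> \<theta> > 0" by (simp add: inner_diff_left)
  have "\<theta> - x \<in> R" using assms theta_in_R by (intro sub_root) (auto simp: inner_commute)
  then show "\<theta> - x \<in> P" using p P_if_theta_inner_pos by auto
qed

text \<open>Each summand has degree at least 1 against \<open>\<theta>\<close>, so the sum has
  degree at least 2, which only \<open>\<theta>\<close> attains.\<close>

lemma theta_inner_sum:
  assumes "x \<in> R" "y \<in> R" "x + y \<in> R" "x \<bullet> \<theta> > 0" "y \<bullet> \<theta> > 0" shows "x + y = \<theta>"
proof (rule ccontr)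
  assume "x + y \<noteq> \<theta>"
  moreover have "(x + y) \<bullet> \<theta> > 0" using assms by (simp add: inner_add_left)
  ultimately have "2 * ((x + y) \<bullet> \<theta>) = \<theta> \<bullet> \<theta>" using theta_inner_eq assms by blast
  then show False using theta_inner_ge[of x] theta_inner_ge[of y] assms root_pos[OF theta_in_R]
    by (simp add: inner_add_left)
qed

lemma P_add: "\<lbrakk>x \<in> P; y \<in> P; x + y \<in> R\<rbrakk> \<Longrightarrow> x + y \<in> P"
  using root_ge_P[of x "x + y"] root_le_add by auto

section \<open>The ideals attached to one long simple root\<close>

context
  fixes \<alpha> assumes alpha: "\<alpha> \<in> long_simple_roots R B"
begin

abbreviation w where "w \<equiv> w_of R B \<alpha>"

lemma alpha_B: "\<alpha> \<in> B" and alpha_long: "\<alpha> \<in> long_roots R"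
  using alpha by (auto simp: long_simple_roots_def)

lemmas w_weyl = w_of_props(1)[OF alpha_long]
  and w_theta = w_of_props(2)[OF alpha_long]
  and w_pos = w_of_props(3)[OF alpha_long]

lemma w_add: "w (x + y) = w x + w y" and w_diff: "w (x - y) = w x - w y" and w_neg: "w (- x) = - w x"
  using weyl_linear[OF w_weyl] by (simp_all add: linear_add linear_diff linear_neg)

lemma w_inner_alpha: "w x \<bullet> \<alpha> = x \<bullet> \<theta>"
  using weyl_inner[OF w_weyl, of x \<theta>] by (simp add: w_theta)

lemma alpha_not_sum: "\<lbrakk>x \<in> P; y \<in> P\<rbrakk> \<Longrightarrow> x + y \<noteq> \<alpha>"
  using ht_P_ge1[of x] ht_P_ge1[of y] ht_add[of x y] ht_base[OF alpha_B] by auto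

text \<open>By \<open>w_pos\<close> an element of \<open>inv_set R B w\<close> is not orthogonal to
  \<open>\<theta>\<close>, so \<open>x\<close> and \<open>\<theta> - x\<close> both lie in
  \<open>H_set R B\<close>. Their images sum to the simple root \<open>\<alpha>\<close>, which
  forces exactly one of them to be positive.\<close>

lemma I_min_eq: "I_min R B \<alpha> = {x \<in> H_set R B. w x \<in> P}" (is "?L = ?R")
proof
  have th: "\<theta> \<in> ?R" using theta(1) root_pos[OF theta_in_R] B_in_P[OF alpha_B] by (simp add: H_iff w_theta)
  have "\<theta> - x \<in> ?R" if x: "x \<in> inv_set R B w" for x
  proof -
    have xP: "x \<in> P" and nx: "- w x \<in> P" using x by (auto simp: inv_set_def)
    have "x \<bullet> \<theta> \<noteq> 0" using w_pos[OF xP] nx P_not_neg by auto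
    then have xt: "x \<bullet> \<theta> > 0" using theta_inner_P[OF xP] by simp
    have "x \<noteq> \<theta>" using nx w_theta B_in_P[OF alpha_B] P_not_neg by auto
    note d = theta_diff_root[OF P_in_R[OF xP] xt this]
    have "w (\<theta> - x) = \<alpha> + (- w x)" by (simp add: w_diff w_theta)
    moreover have "w (\<theta> - x) \<in> R" using weyl_in_R[OF w_weyl] d P_in_R by auto
    ultimately have "w (\<theta> - x) \<in> P" using P_add[OF B_in_P[OF alpha_B] nx] by simp
    then show ?thesis using d by (simp add: H_iff)
  qed
  then show "?L \<subseteq> ?R" using th by (auto simp: I_min_def)
  show "?R \<subseteq> ?L"
  proof
    fix x assume "x \<in> ?R"
    then have x: "x \<in> P" "x \<bullet> \<theta> > 0" "w x \<in> P" by (auto simp: H_iff)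
    show "x \<in> ?L"
    proof (cases "x = \<theta>")
      case False
      note d = theta_diff_root[OF P_in_R[OF x(1)] x(2) False]
      have "w (\<theta> - x) \<notin> P" using alpha_not_sum[of "w (\<theta> - x)" "w x"] x by (auto simp: w_diff w_theta)
      then have "- w (\<theta> - x) \<in> P" using R_cases weyl_in_R[OF w_weyl] d P_in_R by blast
      then have "w (\<theta> - x) \<in> uminus ` P" by (metis add.inverse_inverse imageI)
      then have "\<theta> - x \<in> inv_set R B w" using d by (simp add: inv_set_def)
      then have "\<exists>y. x = \<theta> - y \<and> y \<in> inv_set R B w" by (intro exI[of _ "\<theta> - x"]) simp
      then show ?thesis by (simp add: I_min_def)
    qed (simp add: I_min_def)
  qed
qed

text \<open>Adding a simple root orthogonal to \<open>\<theta>\<close> keeps the image positive by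
  \<open>w_pos\<close>; any other simple root can only lead to \<open>\<theta>\<close>
  itself.\<close>

lemma I_min_root_le:
  assumes "x \<in> I_min R B \<alpha>" "y \<in> P" "root_le B x y" shows "y \<in> I_min R B \<alpha>"
proof (rule root_le_ideal[OF assms(3)])
  fix z b assume z: "z \<in> I_min R B \<alpha>" "z \<in> P" and b: "b \<in> B" "z + b \<in> P"
  have zt: "z \<bullet> \<theta> > 0" "w z \<in> P" using z by (auto simp: I_min_eq H_iff)
  have bt: "b \<bullet> \<theta> \<ge> 0" using theta_inner_P B_in_P b by auto
  have "w (z + b) \<in> P"
  proof (cases "b \<bullet> \<theta> = 0")
    case True
    then have "w b \<in> P" using w_pos B_in_P b by auto
    then show ?thesis using P_add[of "w z" "w b"] zt weyl_in_R[OF w_weyl P_in_R[OF b(2)]] by (simp add: w_add)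
  next
    case False
    then have "z + b = \<theta>" using theta_inner_sum[of z b] z b zt bt B_in_R P_in_R by auto
    then show ?thesis using w_theta B_in_P alpha_B by auto
  qed
  then show "z + b \<in> I_min R B \<alpha>" using b bt zt by (simp add: I_min_eq H_iff inner_add_left)
qed (use assms in \<open>auto simp: I_min_eq H_iff\<close>)

text \<open>Climb from \<open>w x\<close> to \<open>\<theta>\<close> by simple roots \<open>b\<close>. Steps with \<open>b\<close> orthogonal to \<open>\<alpha>\<close> lift to
  \<open>x\<close>; at the first other step, \<open>- w\<^sup>-\<^sup>1 b\<close> is the wanted root.\<close>

lemma H_above_not_I_min:
  assumes "x \<in> P" "x \<bullet> \<theta> = 0" "b0 \<in> B" "b0 \<bullet> \<alpha> \<noteq> 0" "cf (w x) b0 \<noteq> cf \<theta> b0"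
  shows "\<exists>y\<in>H_set R B. root_le B x y \<and> y \<notin> I_min R B \<alpha>"
  using assms(1,2,5)
proof (induction "nat \<lfloor>ht (\<theta> - w x)\<rfloor>" arbitrary: x rule: less_induct)
  case less
  obtain v where v: "v \<in> weyl_group R" "\<And>x. v (w x) = x" "\<And>x. w (v x) = x"
    using weyl_inverse_ex[OF w_weyl] by blast
  have v_add: "v (y + z) = v y + v z" for y z using weyl_linear[OF v(1)] linear_add by blast
  have v_inner: "v y \<bullet> \<theta> = y \<bullet> \<alpha>" for y using w_inner_alpha[of "v y"] v by simp
  have wx: "w x \<in> P" using w_pos less.prems by auto
  have wxa: "w x \<bullet> \<alpha> = 0" using less.prems w_inner_alpha by simp
  \<comment> \<open>The coordinate at \<open>b0\<close> still differs from that of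
    \<open>\<theta>\<close>, so the climb has not ended.\<close>
  have "w x \<noteq> \<theta>" using less.prems by auto
  then obtain b where b: "b \<in> B" "w x + b \<in> P" using root_cover wx by blast
  have vb: "v b \<in> R" using weyl_in_R v b B_in_R by auto
  have xb: "x + v b \<in> R" using weyl_in_R[OF v(1) P_in_R[OF b(2)]] by (simp add: v_add v)
  show ?case
  proof (cases "b \<bullet> \<alpha> = 0")
    case True
    have vbP: "v b \<in> P"
    proof (rule ccontr)
      assume "v b \<notin> P"
      then have n: "- v b \<in> P" using vb R_cases by auto
      have "w (- v b) \<in> P" using w_pos[OF n] True v_inner by simp
      then show False using P_not_neg B_in_P b by (simp add: w_neg v)
    qed
    have P: "x + v b \<in> P" using P_add vbP less.prems xb by auto
    have w': "w (x + v b) = w x + b" by (simp add: w_add v)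
    have nat: "ht (\<theta> - w x) \<in> \<nat>" "ht (\<theta> - w (x + v b)) \<in> \<nat>"
      using theta(2)[OF wx] theta(2)[OF b(2)] ht_nat by (auto simp: root_le_def w')
    have "\<exists>y\<in>H_set R B. root_le B (x + v b) y \<and> y \<notin> I_min R B \<alpha>"
    proof (rule less.hyps)
      have "ht (\<theta> - w (x + v b)) = ht (\<theta> - w x) - 1" using b by (simp add: w' ht_diff ht_add ht_base)
      then show "nat \<lfloor>ht (\<theta> - w (x + v b))\<rfloor> < nat \<lfloor>ht (\<theta> - w x)\<rfloor>" using nat by (auto elim!: Nats_cases)
      show "(x + v b) \<bullet> \<theta> = 0" using less.prems True by (simp add: inner_add_left v_inner)
      \<comment> \<open>As \<open>b0\<close> is not orthogonal to \<open>\<alpha>\<close>, this step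
        leaves the coordinate at \<open>b0\<close> alone.\<close>
      have "b \<noteq> b0" using True assms(4) by auto
      then show "cf (w (x + v b)) b0 \<noteq> cf \<theta> b0" using less.prems b by (simp add: w' cf_add cf_base)
    qed (rule P)
    then show ?thesis using root_le_add[OF vbP, of x] root_le_trans by blast
  next
    case False
    \<comment> \<open>Since \<open>w x\<close> is orthogonal to \<open>\<alpha>\<close>, the root
      \<open>w x + \<alpha>\<close> would be longer than the long root
      \<open>\<alpha>\<close>.\<close>
    have "b \<noteq> \<alpha>"
    proof
      assume "b = \<alpha>"
      then have "(w x + b) \<bullet> (w x + b) = w x \<bullet> w x + \<alpha> \<bullet> \<alpha>"
        using wxa by (simp add: inner_add_left inner_add_right inner_commute[of \<alpha> "w x"])
      then have "(w x + b) \<bullet> (w x + b) > \<alpha> \<bullet> \<alpha>" using root_pos[OF P_in_R[OF wx]] by simp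
      moreover have "(w x + b) \<bullet> (w x + b) \<le> \<alpha> \<bullet> \<alpha>"
        using alpha_long P_in_R[OF b(2)] by (simp add: long_roots_def)
      ultimately show False by simp
    qed
    then have ba: "b \<bullet> \<alpha> < 0" using base_inner_nonpos[OF b(1) alpha_B] False by simp
    have "- v b \<in> R" "- v b \<bullet> \<theta> > 0" using vb R_uminus ba v_inner by auto
    then have y: "- v b \<in> H_set R B" using P_if_theta_inner_pos by (simp add: H_iff)
    have "- b \<notin> P" using P_not_neg B_in_P b by auto
    then have "- v b \<notin> I_min R B \<alpha>" by (simp add: I_min_eq w_neg v)
    \<comment> \<open>The gap from \<open>x\<close> up to \<open>- v b\<close> is the root
      \<open>- (x + v b)\<close>, positive because it pairs positively with
      \<open>\<theta>\<close>.\<close>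
    moreover have "- (x + v b) \<bullet> \<theta> > 0" using ba less.prems(2) by (simp add: inner_diff_left v_inner)
    then have "- (x + v b) \<in> P" by (rule P_if_theta_inner_pos[OF R_uminus[OF xb]])
    from root_le_add[OF this, of x] have "root_le B x (- v b)" by simp
    ultimately show ?thesis using y by blast
  qed
qed

definition I_top where
  "I_top = {x \<in> P. \<forall>y\<in>H_set R B. root_le B x y \<longrightarrow> y \<in> I_min R B \<alpha>}"

lemma I_top_inter_H: "I_top \<inter> H_set R B = I_min R B \<alpha>"
proof
  show "I_top \<inter> H_set R B \<subseteq> I_min R B \<alpha>" using root_le_refl by (auto simp: I_top_def)
  show "I_min R B \<alpha> \<subseteq> I_top \<inter> H_set R B"
  proof
    fix x assume x: "x \<in> I_min R B \<alpha>"
    then have "x \<in> H_set R B" unfolding I_min_eq by blast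
    moreover have "y \<in> I_min R B \<alpha>" if "y \<in> H_set R B" "root_le B x y" for y
      using I_min_root_le[OF x _ that(2)] that(1) unfolding H_iff by blast
    ultimately show "x \<in> I_top \<inter> H_set R B" by (simp add: I_top_def H_iff)
  qed
qed

lemma I_top_upper: "\<lbrakk>x \<in> I_top; y \<in> P; root_le B x y\<rbrakk> \<Longrightarrow> y \<in> I_top"
  using root_le_trans unfolding I_top_def by blast

lemma I_top_cf: "\<lbrakk>x \<in> I_top; x \<bullet> \<theta> = 0; b \<in> B; b \<bullet> \<alpha> \<noteq> 0\<rbrakk> \<Longrightarrow> cf (w x) b = cf \<theta> b"
  using H_above_not_I_min[of x b] by (auto simp: I_top_def)

lemma I_top_w_pos: "\<lbrakk>x \<in> I_top; x \<bullet> \<theta> > 0\<rbrakk> \<Longrightarrow> w x \<in> P"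
  using root_le_refl by (auto simp: I_top_def I_min_eq H_iff)

lemma I_top_abelian: "abelian_ideal R B I_top"
  unfolding abelian_ideal_def
proof (intro conjI ballI)
  show "upper_ideal R B I_top"
    unfolding upper_ideal_def
  proof (intro conjI ballI impI)
    fix x y assume "x \<in> I_top" "y \<in> P" "y + x \<in> P"
    then show "y + x \<in> I_top" using I_top_upper[of x "y + x"] root_le_add[of y x] by (simp add: add.commute)
  qed (auto simp: I_top_def)
  \<comment> \<open>The image of \<open>y\<close> already has the coordinates of
    \<open>\<theta>\<close> at every simple root not orthogonal to \<open>\<alpha>\<close>. Hence
    \<open>w x\<close> vanishes at all of these and is orthogonal to \<open>\<alpha>\<close>,
    contrary to \<open>x \<bullet> \<theta> > 0\<close>.\<close>
  have mixed: False
    if x: "x \<in> I_top" and y: "y \<in> I_top" and xy: "x + y \<in> P" and xt: "x \<bullet> \<theta> > 0" and yt: "y \<bullet> \<theta> = 0" for x y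
  proof -
    note wx = I_top_w_pos[OF x xt]
    have r: "w (x + y) \<in> R" using weyl_in_R[OF w_weyl] xy P_in_R by auto
    have "cf (w x) b * (b \<bullet> \<alpha>) = 0" if b: "b \<in> B" for b
      using I_top_cf[OF y yt b] root_cf_le_theta[OF r b] P_cf_nonneg[OF wx b]
      by (cases "b \<bullet> \<alpha> = 0") (auto simp: w_add cf_add)
    then have "w x \<bullet> \<alpha> = 0" unfolding inner_expand[of "w x" \<alpha>] by (intro sum.neutral ballI)
    then show False using xt by (simp add: w_inner_alpha)
  qed
  fix x y assume x: "x \<in> I_top" and y: "y \<in> I_top"
  have xP: "x \<in> P" and yP: "y \<in> P" using x y by (auto simp: I_top_def)
  show "x + y \<notin> P"
  proof
    assume xy: "x + y \<in> P"
    consider "x \<bullet> \<theta> > 0" "y \<bullet> \<theta> > 0" | "x \<bullet> \<theta> > 0" "y \<bullet> \<theta> = 0" | "x \<bullet> \<theta> = 0" "y \<bullet> \<theta> > 0" | "x \<bullet> \<theta> = 0" "y \<bullet> \<theta> = 0"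
      using theta_inner_P[OF xP] theta_inner_P[OF yP] by linarith
    then show False
    proof cases
      \<comment> \<open>Here \<open>x + y = \<theta>\<close>, and applying \<open>w\<close> would
        write the simple root \<open>\<alpha>\<close> as a sum of two positive roots.\<close>
      case 1
      then have "w x \<in> P" "w y \<in> P" using x y I_top_w_pos by blast+
      moreover have "x + y = \<theta>" using 1 xP yP xy P_in_R by (intro theta_inner_sum) auto
      then have "w x + w y = \<alpha>" using w_theta w_add by metis
      ultimately show False using alpha_not_sum by auto
    next
      case 2
      then show False using mixed x y xy by auto
    next
      case 3
      then show False using mixed[of y x] x y xy by (auto simp: add.commute)
    next
      \<comment> \<open>Both images have the full coordinate of \<open>\<theta>\<close> at
        \<open>\<alpha>\<close>, so their sum would have twice that.\<close>
      case 4
      have "\<alpha> \<bullet> \<alpha> \<noteq> 0" using root_pos[OF B_in_R[OF alpha_B]] by simp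
      then have "cf (w (x + y)) \<alpha> = 2 * cf \<theta> \<alpha>"
        using I_top_cf[OF x _ alpha_B] I_top_cf[OF y _ alpha_B] 4 by (simp add: w_add cf_add)
      moreover have "cf (w (x + y)) \<alpha> \<le> cf \<theta> \<alpha>"
        using root_cf_le_theta weyl_in_R[OF w_weyl] xy P_in_R alpha_B by auto
      ultimately show False using theta_cf_pos[OF alpha_B] by simp
    qed
  qed
qed

lemma I_max_eq: "I_max R B \<alpha> = I_top"
  unfolding I_max_def
proof (rule the_equality)
  have "\<theta> \<in> I_min R B \<alpha>" by (simp add: I_min_def)
  then have ne: "I_top \<noteq> {}" using I_top_inter_H by blast
  \<comment> \<open>An element of \<open>J\<close> pulls every element of \<open>H_set R B\<close>
    above it into \<open>J\<close>, hence into the prescribed intersection.\<close>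
  have max: "J \<subseteq> I_top" if J: "abelian_ideal R B J \<and> J \<inter> H_set R B = I_min R B \<alpha>" for J
  proof
    fix x assume x: "x \<in> J"
    have up: "upper_ideal R B J" using J by (simp add: abelian_ideal_def)
    then have "x \<in> P" using x by (auto simp: upper_ideal_def)
    moreover have "y \<in> I_min R B \<alpha>" if "y \<in> H_set R B" "root_le B x y" for y
    proof -
      have "y \<in> J" using upper_ideal_root_le[OF up that(2) x] that(1) by (simp add: H_iff)
      then show ?thesis using J that(1) by blast
    qed
    ultimately show "x \<in> I_top" by (simp add: I_top_def)
  qed
  show I: "I_top \<noteq> {} \<and> abelian_ideal R B I_top \<and> I_top \<inter> H_set R B = I_min R B \<alpha> \<and>
    (\<forall>J. J \<noteq> {} \<and> abelian_ideal R B J \<and> J \<inter> H_set R B = I_min R B \<alpha> \<longrightarrow> J \<subseteq> I_top)"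
    using max by (intro conjI ne I_top_abelian I_top_inter_H allI impI) blast
  fix I assume I': "I \<noteq> {} \<and> abelian_ideal R B I \<and> I \<inter> H_set R B = I_min R B \<alpha> \<and>
    (\<forall>J. J \<noteq> {} \<and> abelian_ideal R B J \<and> J \<inter> H_set R B = I_min R B \<alpha> \<longrightarrow> J \<subseteq> I)"
  show "I = I_top"
  proof
    show "I \<subseteq> I_top" using max I' by blast
    show "I_top \<subseteq> I"
      using I'[THEN conjunct2, THEN conjunct2, THEN conjunct2, rule_format, of I_top]
        ne I_top_abelian I_top_inter_H by (elim meta_mp) (intro conjI)
  qed
qed

lemma mem_I_max_iff:
  "x \<in> I_max R B \<alpha> \<longleftrightarrow> x \<in> P \<and> (\<forall>y\<in>H_set R B. root_le B x y \<longrightarrow> y \<in> I_min R B \<alpha>)"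
  by (simp add: I_max_eq I_top_def)

end

subsection \<open>The Dynkin diagram\<close>

definition edges :: "'a set \<Rightarrow> 'a set set" where
  "edges X = {{c, d} | c d. c \<in> X \<and> d \<in> X \<and> c \<noteq> d \<and> c \<bullet> d \<noteq> 0}"

lemma finite_edges: "finite X \<Longrightarrow> finite (edges X)"
  by (rule finite_subset[of _ "Pow X"]) (auto simp: edges_def)

lemma edgesI: "\<lbrakk>c \<in> X; d \<in> X; c \<noteq> d; c \<bullet> d \<noteq> 0\<rbrakk> \<Longrightarrow> {c, d} \<in> edges X"
  by (auto simp: edges_def)

lemma edges_sub: "e \<in> edges X \<Longrightarrow> e \<subseteq> X"
  by (auto simp: edges_def)

lemma edges_mono: "X \<subseteq> Y \<Longrightarrow> edges X \<subseteq> edges Y"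
  unfolding edges_def by blast

text \<open>The new edges correspond bijectively to the neighbours of \<open>x\<close> in
  \<open>X\<close>; both edge estimates below build on this count.\<close>

lemma card_edges_insert:
  assumes "finite X" "x \<notin> X"
  shows "card (edges (insert x X)) = card (edges X) + card {y\<in>X. x \<bullet> y \<noteq> 0}"
proof -
  let ?N = "{y\<in>X. x \<bullet> y \<noteq> 0}"
  have "edges (insert x X) = edges X \<union> (\<lambda>y. {x, y}) ` ?N"
  proof
    show "edges (insert x X) \<subseteq> edges X \<union> (\<lambda>y. {x, y}) ` ?N"
    proof
      fix e assume "e \<in> edges (insert x X)"
      then obtain c d where e: "e = {c, d}" "c \<in> insert x X" "d \<in> insert x X" "c \<noteq> d" "c \<bullet> d \<noteq> 0"
        unfolding edges_def by blast
      consider "c = x" "d \<in> X" | "d = x" "c \<in> X" | "c \<in> X" "d \<in> X" using e by blast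
      then show "e \<in> edges X \<union> (\<lambda>y. {x, y}) ` ?N"
      proof cases
        case 2
        then have "e = {x, c}" "c \<in> ?N" using e by (auto simp: inner_commute)
        then show ?thesis by blast
      qed (use e in \<open>auto simp: edges_def\<close>)
    qed
    show "edges X \<union> (\<lambda>y. {x, y}) ` ?N \<subseteq> edges (insert x X)"
      using assms(2) unfolding edges_def by blast
  qed
  moreover have "edges X \<inter> (\<lambda>y. {x, y}) ` ?N = {}" using assms(2) edges_sub[of _ X] by blast
  moreover have "inj_on (\<lambda>y. {x, y}) ?N" using assms(2) by (auto simp: inj_on_def doubleton_eq_iff)
  ultimately show ?thesis
    using assms finite_edges by (simp add: card_Un_disjoint card_image)
qed

section \<open>Edge counts from normalised simple roots\<close>

definition unit :: "'a \<Rightarrow> 'a" where "unit x = (1 / norm x) *\<^sub>R x"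

lemma unit_inner: "unit x \<bullet> unit y = (x \<bullet> y) / (norm x * norm y)"
  by (simp add: unit_def)

lemma unit_inner_self: "x \<in> R \<Longrightarrow> unit x \<bullet> unit x = 1"
  using zero_notin_R by (simp add: unit_def power2_norm_eq_inner[symmetric] power2_eq_square) metis

lemma unit_inner_abs_ge:
  assumes "x \<in> R" "y \<in> R" "x \<bullet> y \<noteq> 0" shows "\<bar>unit x \<bullet> unit y\<bar> \<ge> 1 / 2"
proof -
  have n: "norm x > 0" "norm y > 0" using assms by auto
  have "(norm x * norm y)^2 \<le> (2 * (x \<bullet> y))^2"
    using cartan_prod_ge_1[OF assms] by (simp add: power_mult_distrib power2_norm_eq_inner)
  then have "norm x * norm y \<le> 2 * \<bar>x \<bullet> y\<bar>"
    using n by (metis abs_le_square_iff abs_mult abs_norm_cancel abs_numeral)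
  then show ?thesis using n by (simp add: unit_inner abs_mult field_simps)
qed

lemma unit_base_inner:
  assumes "x \<in> B" "y \<in> B" "x \<noteq> y"
  shows "unit x \<bullet> unit y \<le> (if x \<bullet> y \<noteq> 0 then - 1 / 2 else 0)"
proof -
  have "unit x \<bullet> unit y \<le> 0"
    using base_inner_nonpos[OF assms] by (simp add: unit_inner divide_nonpos_nonneg)
  then have "x \<bullet> y \<noteq> 0 \<Longrightarrow> unit x \<bullet> unit y \<le> - 1 / 2"
    using unit_inner_abs_ge[OF B_in_R[OF assms(1)] B_in_R[OF assms(2)]] by linarith
  then show ?thesis using \<open>unit x \<bullet> unit y \<le> 0\<close> by simp
qed

lemma unit_sum_inner:
  assumes "finite X" "X \<subseteq> B" "x \<in> B" "x \<notin> X"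
  shows "(\<Sum>y\<in>X. unit y) \<bullet> unit x \<le> - real (card {y\<in>X. x \<bullet> y \<noteq> 0}) / 2"
proof -
  have "(\<Sum>y\<in>X. unit y) \<bullet> unit x = (\<Sum>y\<in>X. unit x \<bullet> unit y)"
    unfolding inner_sum_left by (intro sum.cong inner_commute refl)
  also have "\<dots> \<le> (\<Sum>y\<in>X. if x \<bullet> y \<noteq> 0 then - 1 / 2 else 0)"
    using assms by (intro sum_mono unit_base_inner) auto
  also have "\<dots> = - real (card {y\<in>X. x \<bullet> y \<noteq> 0}) / 2"
    using assms(1) by (simp add: sum.If_cases Int_def)
  finally show ?thesis .
qed

text \<open>Each vertex contributes 1 and each edge at most -1, since adjacent unit vectors have
  inner product at most -1/2 and occur twice.\<close>

lemma unit_sum_norm: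
  assumes "finite X" "X \<subseteq> B"
  shows "(\<Sum>x\<in>X. unit x) \<bullet> (\<Sum>x\<in>X. unit x) \<le> real (card X) - real (card (edges X))"
  using assms
proof (induction X rule: finite_induct)
  case (insert x X)
  let ?s = "\<Sum>y\<in>X. unit y"
  have "(\<Sum>y\<in>insert x X. unit y) \<bullet> (\<Sum>y\<in>insert x X. unit y) = 1 + 2 * (?s \<bullet> unit x) + ?s \<bullet> ?s"
    using insert unit_inner_self[of x] B_in_R
    by (simp add: inner_add_left inner_add_right inner_commute[of "unit x" ?s])
  also have "\<dots> \<le> 1 - real (card {y\<in>X. x \<bullet> y \<noteq> 0}) + (real (card X) - real (card (edges X)))"
    using unit_sum_inner[of X x] insert by simp
  also have "\<dots> = real (card (insert x X)) - real (card (edges (insert x X)))"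
    using insert card_edges_insert[of X x] by simp
  finally show ?case .
qed (simp add: edges_def)

lemma cf_unit: "b \<in> B \<Longrightarrow> cf (unit b) c = (if c = b then 1 / norm b else 0)"
  by (simp add: unit_def cf_scale cf_base)

lemma cf_unit_sum:
  assumes "X \<subseteq> B" "c \<in> X" shows "cf (\<Sum>x\<in>X. unit x) c = 1 / norm c"
proof -
  have X: "finite X" using assms finite_B finite_subset by auto
  have "cf (\<Sum>x\<in>X. unit x) c = (\<Sum>x\<in>X. cf (unit x) c)"
    by (subst representation_sum[OF indep_B]) (auto simp: span_B)
  also have "\<dots> = (\<Sum>x\<in>X. if x = c then 1 / norm c else 0)"
    using assms by (intro sum.cong) (auto simp: cf_unit)
  finally show ?thesis using assms X by simp
qed

text \<open>Independence makes the sum of the normalised roots nonzero, so the bound on its squared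
  norm is positive. Applied to every subset this excludes cycles.\<close>

lemma card_edges_less:
  assumes "X \<subseteq> B" "X \<noteq> {}" shows "card (edges X) < card X"
proof -
  have X: "finite X" using assms finite_B finite_subset by auto
  obtain c where c: "c \<in> X" using assms by auto
  have "c \<noteq> 0" using c assms B_in_R zero_notin_R by auto
  then have "(\<Sum>x\<in>X. unit x) \<noteq> 0"
    using cf_unit_sum[OF assms(1) c] by (auto simp: representation_zero)
  then have "(\<Sum>x\<in>X. unit x) \<bullet> (\<Sum>x\<in>X. unit x) > 0" by simp
  then have "0 < real (card X) - real (card (edges X))" using unit_sum_norm[OF X assms(1)] by (rule less_le_trans)
  then show ?thesis by simp
qed

text \<open>A subset is grown one vertex at a time; connectedness supplies a vertex joined to the
  part already built, and every vertex after the first adds an edge.\<close>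

lemma card_edges_conn:
  assumes "finite X" "conn X" shows "card X \<le> card (edges X) + 1"
proof -
  have "\<exists>Y\<subseteq>X. card Y = n \<and> n \<le> card (edges Y) + 1" if "n \<le> card X" for n
    using that
  proof (induction n)
    case 0
    show ?case by (intro exI[of _ "{}"]) auto
  next
    case (Suc n)
    then obtain Y where Y: "Y \<subseteq> X" "card Y = n" "n \<le> card (edges Y) + 1" by auto
    have fY: "finite Y" using Y assms finite_subset by auto
    have ne: "X - Y \<noteq> {}" using Y Suc.prems by (metis Diff_eq_empty_iff card_mono fY not_less_eq_eq)
    show ?case
    proof (cases "Y = {}")
      case True
      obtain x where "x \<in> X" using ne by auto
      then show ?thesis using Y True by (intro exI[of _ "{x}"]) auto
    next
      case False
      then have "\<exists>c\<in>Y. \<exists>d\<in>X - Y. c \<bullet> d \<noteq> 0"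
        using assms(2)[unfolded conn_def, rule_format, of Y "X - Y"] Y ne by blast
      then obtain c d where cd: "c \<in> Y" "d \<in> X - Y" "c \<bullet> d \<noteq> 0" by blast
      have "card {y\<in>Y. d \<bullet> y \<noteq> 0} \<noteq> 0" using cd fY by (auto simp: inner_commute[of d c])
      then have "Suc n \<le> card (edges (insert d Y)) + 1" using card_edges_insert[OF fY, of d] cd Y by simp
      then show ?thesis using Y cd fY by (intro exI[of _ "insert d Y"]) auto
    qed
  qed
  from this[of "card X"] obtain Y where "Y \<subseteq> X" "card Y = card X" "card X \<le> card (edges Y) + 1" by auto
  then show ?thesis using card_subset_eq[OF assms(1)] by metis
qed

text \<open>The Dynkin diagram is a forest: both facts on edge counts together force the intersection
  of two subtrees to have at least as many edges as a tree.\<close>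

lemma conn_Int:
  assumes "conn X" "conn Y" "X \<subseteq> B" "Y \<subseteq> B" shows "conn (X \<inter> Y)"
  unfolding conn_def
proof (intro allI impI, rule ccontr)
  fix C D assume CD: "C \<union> D = X \<inter> Y \<and> C \<inter> D = {} \<and> C \<noteq> {} \<and> D \<noteq> {}"
    and "\<not> (\<exists>c\<in>C. \<exists>d\<in>D. c \<bullet> d \<noteq> 0)"
  then have orth: "c \<bullet> d = 0" "d \<bullet> c = 0" if "c \<in> C" "d \<in> D" for c d
    using that by (auto simp: inner_commute)
  have fin: "finite X" "finite Y" using assms finite_B finite_subset by auto
  have finCD: "finite C" "finite D" using CD fin by (metis finite_Int finite_Un)+
  have sub: "C \<subseteq> B" "D \<subseteq> B" using CD assms by auto
  have "edges (X \<inter> Y) \<subseteq> edges C \<union> edges D"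
  proof
    fix e assume "e \<in> edges (X \<inter> Y)"
    then obtain c d where e: "e = {c, d}" "c \<in> C \<union> D" "d \<in> C \<union> D" "c \<noteq> d" "c \<bullet> d \<noteq> 0"
      using CD unfolding edges_def by blast
    then have "c \<in> C \<and> d \<in> C \<or> c \<in> D \<and> d \<in> D" using orth by blast
    then show "e \<in> edges C \<union> edges D" using e unfolding edges_def by blast
  qed
  then have "card (edges (X \<inter> Y)) \<le> card (edges C \<union> edges D)"
    using finCD finite_edges by (intro card_mono) auto
  also have "\<dots> \<le> card (edges C) + card (edges D)" by (rule card_Un_le)
  finally have 1: "card (edges (X \<inter> Y)) \<le> card (edges C) + card (edges D)" .
  have 2: "card (edges C) < card C" "card (edges D) < card D" using card_edges_less sub CD by auto
  have 3: "card C + card D = card (X \<inter> Y)" using CD finCD by (metis card_Un_disjoint)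
  have "edges X \<inter> edges Y \<subseteq> edges (X \<inter> Y)"
  proof
    fix e assume "e \<in> edges X \<inter> edges Y"
    then obtain c d where e: "e = {c, d}" "c \<in> X" "d \<in> X" "c \<noteq> d" "c \<bullet> d \<noteq> 0" and "e \<in> edges Y"
      unfolding edges_def by blast
    have "e \<subseteq> Y" using \<open>e \<in> edges Y\<close> by (rule edges_sub)
    then have "c \<in> X \<inter> Y" "d \<in> X \<inter> Y" using e(1-3) by auto
    then show "e \<in> edges (X \<inter> Y)" unfolding e(1) using e(4,5) by (rule edgesI)
  qed
  then have 4: "card (edges X \<inter> edges Y) \<le> card (edges (X \<inter> Y))"
    using fin finite_edges by (intro card_mono) auto
  have "card (edges X) + card (edges Y) = card (edges X \<union> edges Y) + card (edges X \<inter> edges Y)"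
    using fin finite_edges by (intro card_Un_Int) auto
  moreover have "card (edges X \<union> edges Y) \<le> card (edges (X \<union> Y))"
    using fin finite_edges edges_mono by (intro card_mono) (auto intro: edges_mono[THEN subsetD])
  moreover have "card (edges (X \<union> Y)) < card (X \<union> Y)" using assms CD by (intro card_edges_less) auto
  moreover have "card X + card Y = card (X \<union> Y) + card (X \<inter> Y)" using fin by (intro card_Un_Int)
  moreover have "card X \<le> card (edges X) + 1" "card Y \<le> card (edges Y) + 1"
    using card_edges_conn assms fin by auto
  \<comment> \<open>With e for edge counts: |X| + |Y| - 2 <= e(X) + e(Y) <= e(X Un Y) + e(X Int Y)
    <= (|X Un Y| - 1) + (|C| - 1) + (|D| - 1) = |X| + |Y| - 3.\<close>
  ultimately show False using 1 2 3 4 by linarith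
qed

text \<open>If two simple roots were not orthogonal to \<open>\<theta>\<close>, the extended diagram would contain a cycle;
  the sum of its normalised vertices then vanishes, which pins down type A.\<close>

lemma unique_theta_neighbour:
  assumes nA: "\<not> type_A R B" and b: "b \<in> B" "b \<bullet> \<theta> \<noteq> 0" and c: "c \<in> B" "c \<bullet> \<theta> \<noteq> 0"
  shows "b = c"
proof (rule ccontr)
  assume bc: "b \<noteq> c"
  have tt: "\<theta> \<bullet> \<theta> > 0" and nt: "norm \<theta> > 0" using root_pos[OF theta_in_R] by auto
  have bt: "b \<bullet> \<theta> > 0" and ct: "c \<bullet> \<theta> > 0"
    using theta_inner_P B_in_P b c by (metis order_le_less)+
  have dom: "d \<bullet> \<theta> \<ge> 0" if "d \<in> B" for d using theta_inner_P B_in_P that by auto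
  let ?s = "\<Sum>d\<in>B. unit d"
  have ss: "?s \<bullet> ?s \<le> 1"
    using unit_sum_norm[OF finite_B order_refl] card_edges_conn[OF finite_B conn_B] by linarith
  have ut: "unit d \<bullet> unit \<theta> \<ge> 0" if "d \<in> B" for d using dom[OF that] by (simp add: unit_inner)
  have ut2: "unit d \<bullet> unit \<theta> \<ge> 1 / 2" if "d \<in> B" "d \<bullet> \<theta> \<noteq> 0" for d
    using unit_inner_abs_ge[of d \<theta>] ut[OF that(1)] that B_in_R theta_in_R by auto
  have sum2: "f b + f c \<le> (\<Sum>d\<in>B. f d)" if "\<And>d. d \<in> B \<Longrightarrow> f d \<ge> 0" for f :: "'a \<Rightarrow> real"
    using sum_mono2[OF finite_B, of "{b, c}" f] b c bc that by auto
  \<comment> \<open>\<open>b\<close> and \<open>c\<close> contribute at least 1/2 each, and all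
    other terms are nonnegative.\<close>
  have st: "?s \<bullet> unit \<theta> \<ge> 1"
    using sum2[of "\<lambda>d. unit d \<bullet> unit \<theta>"] ut ut2[OF b] ut2[OF c] by (simp add: inner_sum_left)
  have "(?s - unit \<theta>) \<bullet> (?s - unit \<theta>) = ?s \<bullet> ?s - 2 * (?s \<bullet> unit \<theta>) + 1"
    using unit_inner_self[OF theta_in_R]
    by (simp add: inner_diff_left inner_diff_right inner_commute[of "unit \<theta>" ?s])
  \<comment> \<open>The two bounds give at most 1 - 2 + 1 = 0.\<close>
  then have "(?s - unit \<theta>) \<bullet> (?s - unit \<theta>) \<le> 0" using ss st by linarith
  then have s_eq: "?s = unit \<theta>" by (metis eq_iff_diff_eq_0 inner_eq_zero_iff inner_ge_zero order_antisym)
  \<comment> \<open>Comparing coordinates in \<open>s_eq\<close>: short simple roots have large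
    coordinates in \<open>\<theta>\<close>.\<close>
  have cf: "cf \<theta> d * norm d = norm \<theta>" if d: "d \<in> B" for d
  proof -
    have "cf (unit \<theta>) d = 1 / norm d" using cf_unit_sum[OF order_refl d] s_eq by simp
    then show ?thesis using nt root_pos[OF B_in_R[OF d]] by (simp add: unit_def cf_scale field_simps)
  qed
  have ge1: "cf \<theta> d \<ge> 1" if "d \<in> B" for d using P_cf_ge1[OF theta(1) that] theta_cf_pos that by auto
  \<comment> \<open>In the expansion of \<open>\<theta> \<bullet> \<theta>\<close>, both
    \<open>b\<close> and \<open>c\<close> pair with \<open>\<theta>\<close> to at least half of the
    total. As the coordinate at \<open>c\<close> is at least 1, at most 1 is left for the coordinate
    at \<open>b\<close>.\<close>
  have "cf \<theta> b * (b \<bullet> \<theta>) + cf \<theta> c * (c \<bullet> \<theta>) \<le> \<theta> \<bullet> \<theta>"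
    unfolding inner_expand[of \<theta> \<theta>] using sum2[of "\<lambda>d. cf \<theta> d * (d \<bullet> \<theta>)"] theta_cf_pos dom by (simp add: less_imp_le)
  moreover have "cf \<theta> b * (b \<bullet> \<theta>) \<ge> cf \<theta> b * (\<theta> \<bullet> \<theta> / 2)"
    using theta_inner_ge[OF B_in_R[OF b(1)] bt] theta_cf_pos[OF b(1)] by (intro mult_left_mono) auto
  moreover have "cf \<theta> c * (c \<bullet> \<theta>) \<ge> 1 * (\<theta> \<bullet> \<theta> / 2)"
    using theta_inner_ge[OF B_in_R[OF c(1)] ct] ge1[OF c(1)] tt by (intro mult_mono) auto
  ultimately have "cf \<theta> b * (\<theta> \<bullet> \<theta> / 2) \<le> 1 * (\<theta> \<bullet> \<theta> / 2)" by linarith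
  then have "cf \<theta> b \<le> 1" using tt by simp
  then have nb: "norm b = norm \<theta>" using ge1[OF b(1)] cf[OF b(1)] by simp
  \<comment> \<open>If \<open>L\<close> were not all of \<open>B\<close>, connectedness would give
    adjacent \<open>l\<close> in \<open>L\<close> and \<open>d\<close> outside it; then
    \<open>\<theta>\<close> has coordinate at least 2 at \<open>d\<close>, so
    \<open>norm l \<ge> 2 * norm d\<close>, which \<open>length_ratio\<close> forbids.\<close>
  define L where "L = {d\<in>B. norm d = norm \<theta>}"
  have "B - L = {}"
  proof (rule ccontr)
    assume "B - L \<noteq> {}"
    moreover have "L \<noteq> {}" using nb b by (auto simp: L_def)
    ultimately have "\<exists>l\<in>L. \<exists>d\<in>B - L. l \<bullet> d \<noteq> 0"
      using conn_B[unfolded conn_def, rule_format, of L "B - L"] by (auto simp: L_def)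
    then obtain l d where ld: "l \<in> B" "norm l = norm \<theta>" "d \<in> B" "norm d \<noteq> norm \<theta>" "l \<bullet> d \<noteq> 0"
      by (auto simp: L_def)
    have "cf \<theta> d \<noteq> 1" using cf[OF ld(3)] ld(4) by auto
    moreover have "cf \<theta> d \<in> \<nat>" using P_cf_nat theta(1) ld(3) by blast
    ultimately have "cf \<theta> d \<ge> 2" using ge1[OF ld(3)] by (auto elim!: Nats_cases)
    then have "norm l \<ge> 2 * norm d"
      unfolding ld(2) cf[OF ld(3), symmetric] by (intro mult_right_mono) auto
    then have "(norm l)^2 \<ge> (2 * norm d)^2" by (intro power_mono) auto
    then have "l \<bullet> l \<ge> 4 * (d \<bullet> d)" by (simp add: power_mult_distrib power2_norm_eq_inner)
    moreover have "l \<bullet> l < 4 * (d \<bullet> d)"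
      using ld by (intro length_ratio B_in_R) auto
    ultimately show False by simp
  qed
  then have norm_B: "norm d = norm \<theta>" if "d \<in> B" for d using that by (auto simp: L_def)
  have norm_R: "x \<bullet> x = \<theta> \<bullet> \<theta>" if x: "x \<in> R" for x
  proof -
    have *: "y \<bullet> y = \<theta> \<bullet> \<theta>" if "y \<in> P" for y
    proof -
      obtain xs a where "a \<in> B" "refl_word xs a = y" using P_simple_conj \<open>y \<in> P\<close> by blast
      then have "y \<bullet> y = a \<bullet> a" using refl_word_inner by auto
      then show ?thesis using norm_B[OF \<open>a \<in> B\<close>] by (simp add: norm_eq)
    qed
    show ?thesis using R_cases[OF x] *[of x] *[of "- x"] by auto
  qed
  \<comment> \<open>The product of \<open>unit a\<close> with \<open>unit \<theta>\<close> is
    nonnegative. In the expansion by \<open>s_eq\<close>, \<open>a\<close> itself gives 1 and each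
    neighbour takes away at least 1/2.\<close>
  have deg: "card {d\<in>B. d \<noteq> a \<and> a \<bullet> d \<noteq> 0} \<le> 2" if a: "a \<in> B" for a
  proof -
    let ?X = "B - {a}"
    have "?s = unit a + (\<Sum>d\<in>?X. unit d)" using sum.remove[OF finite_B a] .
    then have "unit \<theta> \<bullet> unit a = 1 + (\<Sum>d\<in>?X. unit d) \<bullet> unit a"
      using s_eq unit_inner_self[OF B_in_R[OF a]] by (metis inner_add_left)
    also have "\<dots> \<le> 1 - real (card {d\<in>?X. a \<bullet> d \<noteq> 0}) / 2"
      using unit_sum_inner[of ?X a] finite_B a by simp
    finally have "real (card {d\<in>?X. a \<bullet> d \<noteq> 0}) \<le> 2" using ut[OF a] by (simp add: inner_commute)
    moreover have "{d\<in>?X. a \<bullet> d \<noteq> 0} = {d\<in>B. d \<noteq> a \<and> a \<bullet> d \<noteq> 0}" by auto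
    ultimately show ?thesis by simp
  qed
  have "type_A R B" unfolding type_A_def using norm_R deg by metis
  then show False using nA by simp
qed

section \<open>Roots with prescribed support and least elements above a root\<close>

lemma root_with_support:
  assumes "x \<in> P" "conn X" "X \<subseteq> B" "supp x \<subseteq> X"
  shows "\<exists>y\<in>P. \<forall>b\<in>B. cf y b = (if b \<in> X - supp x then 1 else cf x b)"
  using assms(1,4)
proof (induction "card (X - supp x)" arbitrary: x rule: less_induct)
  case less
  have fX: "finite X" using assms finite_B finite_subset by auto
  show ?case
  proof (cases "X - supp x = {}")
    case True
    then show ?thesis using less.prems by (intro bexI[of _ x]) auto
  next
    case False
    have "supp x \<noteq> {}" using P_cf_pos_ex[OF less.prems(1)] by (auto simp: supp_def)
    then have "\<exists>c\<in>supp x. \<exists>d\<in>X - supp x. c \<bullet> d \<noteq> 0"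
      using assms(2)[unfolded conn_def, rule_format, of "supp x" "X - supp x"] less.prems False by blast
    then obtain c d where c: "c \<in> supp x" and d: "d \<in> X" "d \<notin> supp x" and cd: "c \<bullet> d \<noteq> 0" by blast
    have dB: "d \<in> B" using d assms by auto
    have xd: "cf x d = 0" using d dB P_cf_nonneg[OF less.prems(1)] by (force simp: supp_def)
    \<comment> \<open>A neighbour of the support lying outside it pairs negatively with
      \<open>x\<close>, so it can be added, and it enters with coordinate 1.\<close>
    have "x \<bullet> d < 0" using inner_neg_supp[OF less.prems(1) c dB d(2) cd] .
    moreover have "x \<noteq> - d" using less.prems dB B_in_P P_not_neg by auto
    ultimately have "x + d \<in> R" using less.prems dB P_in_R B_in_R by (intro add_root) auto
    then have xdP: "x + d \<in> P" using P_add less.prems dB B_in_P by auto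
    have supp: "supp (x + d) = insert d (supp x)"
      using dB xd by (auto simp: supp_def cf_add cf_base)
    have "card (X - supp (x + d)) < card (X - supp x)"
      using d fX unfolding supp by (intro psubset_card_mono) auto
    then obtain y where y: "y \<in> P" "\<forall>b\<in>B. cf y b = (if b \<in> X - supp (x + d) then 1 else cf (x + d) b)"
      using less.hyps[of "x + d"] xdP less.prems d supp by auto
    have "cf y b = (if b \<in> X - supp x then 1 else cf x b)" if b: "b \<in> B" for b
      using y(2)[rule_format, OF b] d dB xd unfolding supp by (auto simp: cf_add cf_base)
    then show ?thesis using y(1) by blast
  qed
qed

text \<open>Membership in \<open>H_set R B\<close> means that the only simple root \<open>a\<close>
  not orthogonal to \<open>\<theta>\<close> occurs. The least choice extends \<open>x\<close> by
  coordinates 1 over a smallest connected set containing \<open>a\<close> and the support of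
  \<open>x\<close>. By \<open>conn_Int\<close> and minimality, the support of every competitor
  contains that set.\<close>

lemma least_H_above:
  assumes nA: "\<not> type_A R B" and x: "x \<in> P"
  shows "\<exists>e\<in>H_set R B. root_le B x e \<and> (\<forall>y\<in>H_set R B. root_le B x y \<longrightarrow> root_le B e y)"
proof -
  have "\<exists>a\<in>B. a \<bullet> \<theta> \<noteq> 0"
  proof (rule ccontr)
    assume "\<not> ?thesis"
    then have "\<theta> \<bullet> \<theta> = 0" unfolding inner_expand[of \<theta> \<theta>] by (intro sum.neutral) auto
    then show False using root_pos[OF theta_in_R] by simp
  qed
  then obtain a where a: "a \<in> B" "a \<bullet> \<theta> \<noteq> 0" by blast
  then have at: "a \<bullet> \<theta> > 0" using theta_inner_P[OF B_in_P[OF a(1)]] by simp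
  have H: "y \<in> H_set R B \<longleftrightarrow> y \<in> P \<and> a \<in> supp y" for y
  proof -
    have "y \<bullet> \<theta> = (\<Sum>b\<in>B. if b = a then cf y b * (b \<bullet> \<theta>) else 0)"
      unfolding inner_expand[of y \<theta>] using unique_theta_neighbour[OF nA _ _ a] by (intro sum.cong) auto
    then have "y \<bullet> \<theta> = cf y a * (a \<bullet> \<theta>)" using a finite_B by simp
    then show ?thesis using at a by (auto simp: H_iff supp_def zero_less_mult_iff)
  qed
  define K where "K X \<longleftrightarrow> conn X \<and> X \<subseteq> B \<and> supp x \<subseteq> X \<and> a \<in> X" for X
  have "K B" using conn_B supp_sub_B a by (auto simp: K_def)
  then obtain X where X: "K X" and min: "\<And>Y. K Y \<Longrightarrow> card X \<le> card Y"
    using ex_has_least_nat[of K B card] by blast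
  have fX: "finite X" using X finite_B finite_subset by (auto simp: K_def)
  obtain e where e: "e \<in> P" "\<And>b. b \<in> B \<Longrightarrow> cf e b = (if b \<in> X - supp x then 1 else cf x b)"
    using root_with_support[OF x, of X] X by (auto simp: K_def)
  have x0: "cf x b = 0" if "b \<in> B" "b \<notin> supp x" for b using that P_cf_nonneg[OF x] by (force simp: supp_def)
  have "a \<in> supp e" using e(2)[OF a(1)] X a by (auto simp: supp_def K_def)
  then have eH: "e \<in> H_set R B" using H e by simp
  have xe: "root_le B x e"
    using e x0 x P_in_R by (subst root_le_iff_cf) auto
  have "root_le B e y" if y: "y \<in> H_set R B" "root_le B x y" for y
  proof -
    have yP: "y \<in> P" and ya: "a \<in> supp y" using y H by auto
    have cfxy: "cf x b \<le> cf y b" if "b \<in> B" for b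
      using y(2) that root_le_iff_cf x yP P_in_R by blast
    then have "supp x \<subseteq> supp y" by (force simp: supp_def)
    then have "K (X \<inter> supp y)"
      using conn_Int[OF _ conn_supp[OF yP]] X supp_sub_B ya by (auto simp: K_def)
    \<comment> \<open>The intersection is again admissible, so minimality of \<open>X\<close> puts
      all of \<open>X\<close> into the support of \<open>y\<close>.\<close>
    then have "X \<inter> supp y = X" using min fX by (intro card_seteq) auto
    then have "cf y b \<ge> 1" if "b \<in> X" for b using P_cf_ge1[OF yP] that by (auto simp: supp_def)
    then show ?thesis using e cfxy yP P_in_R by (subst root_le_iff_cf) auto
  qed
  then show ?thesis using eH xe by blast
qed

end

theorem theorem4p2:
  fixes R B S :: "'a::euclidean_space set" and \<gamma> :: 'a
  assumes "root_system R" and "reduced_rs R" and "irreducible_rs R"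
    and "is_base R B"
    and "\<not> type_A R B"
    and "S \<subseteq> long_simple_roots R B"
    and "\<gamma> \<in> pos_roots R B - (\<Union>\<alpha>\<in>S. I_max R B \<alpha>)"
    and "\<forall>\<delta>\<in>pos_roots R B - (\<Union>\<alpha>\<in>S. I_max R B \<alpha>). root_le B \<gamma> \<delta> \<longrightarrow> \<delta> = \<gamma>"
  shows "\<gamma> \<in> H_set R B"
proof -
  interpret based_root_system R B using assms by unfold_locales
  have g: "\<gamma> \<in> P" and gI: "\<And>\<alpha>. \<alpha> \<in> S \<Longrightarrow> \<gamma> \<notin> I_max R B \<alpha>" using assms(7) by auto
  obtain e where e: "e \<in> H_set R B" "root_le B \<gamma> e"
    and least: "\<And>y. \<lbrakk>y \<in> H_set R B; root_le B \<gamma> y\<rbrakk> \<Longrightarrow> root_le B e y"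
    using least_H_above[OF assms(5) g] by blast
  have eP: "e \<in> P" using e H_iff by blast
  have "e \<notin> I_max R B \<alpha>" if "\<alpha> \<in> S" for \<alpha>
  proof -
    have \<alpha>: "\<alpha> \<in> long_simple_roots R B" using that assms(6) by blast
    \<comment> \<open>That \<open>\<gamma>\<close> lies outside the ideal is witnessed by some
      \<open>y\<close> above \<open>\<gamma>\<close>. As \<open>e\<close> is least, the same
      \<open>y\<close> lies above \<open>e\<close> and excludes \<open>e\<close> too.\<close>
    obtain y where "y \<in> H_set R B" "root_le B \<gamma> y" "y \<notin> I_min R B \<alpha>"
      using gI[OF \<open>\<alpha> \<in> S\<close>] g unfolding mem_I_max_iff[OF \<alpha>] by blast
    then show ?thesis using least unfolding mem_I_max_iff[OF \<alpha>] by blast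
  qed
  then have "e = \<gamma>" using assms(8) e(2) eP by blast
  then show ?thesis using e(1) by simp
qed

end
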